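(* Let $\Lambda \subset \mathbb{N}$ be an infinite subset and let $f_\Lambda(z)=\sum_{n\in\Lambda} z^n$ for $z\in\mathbb{D}$. Suppose that $f_\Lambda$ belongs to the Bloch space $\mathcal{B}$. Then the determinantal point process on $\mathbb{D}$ (with respect to the normalized Lebesgue measure $dm$) induced by the kernel $$K_\Lambda(z,w)=\sum_{n\in\Lambda}(n+1)z^n\bar w^n,\qquad z,w\in\mathbb{D},$$ is number rigid.
   Context: $\mathbb{N}=\{0,1,2,\dots\}$; $\mathbb{D}$ is the open unit disc in $\mathbb{C}$, equipped with the normalized Lebesgue measure $dm$ (so $m(\mathbb{D})=1$). Bloch space: $\mathcal{B}=\{f \text{ holomorphic on } \mathbb{D} : \|f\|_{\mathcal{B}}:=\sup_{z\in\mathbb{D}}(1-|z|)|f'(z)|<\infty\}$. Point processes: $\mathrm{Conf}(\mathbb{D})$ is the space of configurations on $\mathbb{D}$, i.e. non-negative integer-valued Radon measures on $\mathbb{D}$, with the vague topology (a Polish space). A point process on $\mathbb{D}$ is a Borel probability measure $\mathbb{P}$ on $\mathrm{Conf}(\mathbb{D})$. For a Borel set $B\subset\mathbb{D}$, $\#B:X\mapsto X(B)=\int_B dX$. A bounded subset of $\mathbb{D}$ means a relatively compact subset of $\mathbb{D}$. Determinantal: $\mathbb{P}$ is the determinantal point process induced by the kernel $K:\mathbb{D}\times\mathbb{D}\to\mathbb{C}$ if for all $m\ge1$, all pairwise disjoint bounded Borel sets $B_1,\dots,B_m$ and all integers $n_1,\dots,n_m\ge1$ with $n_1+\dots+n_m=n$,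 $$\mathbb{E}_{\mathbb{P}}\Big[\prod_{i=1}^m\frac{(\#B_i)!}{(\#B_i-n_i)!}\Big]=\int_{B_1^{n_1}\times\cdots\times B_m^{n_m}}\det[K(x_i,x_j)]_{i,j=1}^n\,dm(x_1)\cdots dm(x_n),$$ where $\frac{N!}{(N-k)!}=N(N-1)\cdots(N-k+1)$. The kernel $K_\Lambda$ is the kernel of the orthogonal projection of $L^2(\mathbb{D},dm)$ onto the closed linear span of $\{z^n:n\in\Lambda\}$; this operator is locally of trace class, and it induces a unique determinantal point process. Number rigidity: for a Borel set $C\subset\mathbb{D}$ let $\mathcal{F}_C$ be the $\sigma$-algebra on $\mathrm{Conf}(\mathbb{D})$ generated by all $\#B$ with $B\subset C$ Borel, and let $\mathcal{F}_C^{\mathbb{P}}$ be its completion with respect to $\mathbb{P}$. A point process $\mathbb{P}$ on $\mathbb{D}$ is number rigid if for every bounded Borel set $B\subset\mathbb{D}$ the random variable $\#B$ is $\mathcal{F}_{\mathbb{D}\setminus B}^{\mathbb{P}}$-measurable. *)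

theory Defs
  imports
    "HOL-Probability.Probability"
    "HOL-Complex_Analysis.Complex_Analysis"
    "Jordan_Normal_Form.Determinant"
begin

abbreviation unit_disc :: "complex set" where
  "unit_disc \<equiv> ball 0 1"

(* Normalized area measure dm, as a measure on the whole plane that vanishes off the disc. *)
definition disc_measure :: "complex measure" where
  "disc_measure = uniform_measure lborel unit_disc"

definition bloch_space :: "(complex \<Rightarrow> complex) set" where
  "bloch_space =
     {f. f holomorphic_on unit_disc \<and>
         bdd_above ((\<lambda>z. (1 - norm z) * norm (deriv f z)) ` unit_disc)}"

definition f_Lambda :: "nat set \<Rightarrow> complex \<Rightarrow> complex" where
  "f_Lambda \<Lambda> z = (\<Sum>\<^sub>\<infinity>n\<in>\<Lambda>. z ^ n)"

definition K_Lambda :: "nat set \<Rightarrow> complex \<Rightarrow> complex \<Rightarrow> complex" where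
  "K_Lambda \<Lambda> z w = (\<Sum>\<^sub>\<infinity>n\<in>\<Lambda>. of_nat (n + 1) * z ^ n * cnj w ^ n)"

(* "Bounded" subsets of the disc: closure B is taken in the plane, so this says that B is
   relatively compact in the disc. *)
definition bounded_in_disc :: "complex set \<Rightarrow> bool" where
  "bounded_in_disc B \<longleftrightarrow> compact (closure B) \<and> closure B \<subseteq> unit_disc"

(* Non-negative integer-valued Radon measures. On the disc, a Borel measure is Radon as soon as
   it is finite on compact sets. Integer values include infinity, which is possible only on
   Borel sets that are not relatively compact. *)
definition Conf :: "complex measure set" where
  "Conf =
     {X. sets X = sets (restrict_space borel unit_disc) \<and>
         (\<forall>K. compact K \<longrightarrow> K \<subseteq> unit_disc \<longrightarrow> emeasure X K < \<infinity>) \<and>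
         (\<forall>A\<in>sets X. emeasure X A \<in> range ennreal_of_enat)}"

definition test_functions :: "(complex \<Rightarrow> real) set" where
  "test_functions =
     {f. continuous_on unit_disc f \<and>
         (\<exists>K. compact K \<and> K \<subseteq> unit_disc \<and> (\<forall>x\<in>unit_disc - K. f x = 0))}"

(* The coarsest topology on Conf making all the maps X \<mapsto> \<integral> f dX continuous. *)
definition vague_topology :: "complex measure topology" where
  "vague_topology =
     topology_generated_by
       {{X \<in> Conf. integral\<^sup>L X f \<in> U} |f U. f \<in> test_functions \<and> open U}"

definition conf_borel :: "complex measure measure" where
  "conf_borel = sigma Conf {U. openin vague_topology U}"

definition point_process :: "complex measure measure \<Rightarrow> bool" where
  "point_process P \<longleftrightarrow> prob_space P \<and> sets P = sets conf_borel"

definition falling_factorial :: "real \<Rightarrow> nat \<Rightarrow> real" where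
  "falling_factorial x k = (\<Prod>j<k. x - real j)"

(* The m blocks B 0, ..., B (m - 1) have multiplicities n 0, ..., n (m - 1); the list
   B 0, ..., B 0, B 1, ..., B 1, ... (each B i repeated n i times) gives the factors of the
   domain B 0 ^ n 0 \<times> ... \<times> B (m - 1) ^ n (m - 1), whose points are functions on {..<N}.
   Integrability is required explicitly on both sides because Bochner integrals of
   non-integrable functions are 0 by convention. *)
definition determinantal :: "complex measure measure \<Rightarrow> (complex \<Rightarrow> complex \<Rightarrow> complex) \<Rightarrow> bool" where
  "determinantal P K \<longleftrightarrow>
     point_process P \<and>
     (\<forall>(m::nat) (B :: nat \<Rightarrow> complex set) (n :: nat \<Rightarrow> nat).
        1 \<le> m \<longrightarrow>
        (\<forall>i<m. B i \<in> sets borel \<and> bounded_in_disc (B i)) \<longrightarrow>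
        disjoint_family_on B {..<m} \<longrightarrow>
        (\<forall>i<m. 1 \<le> n i) \<longrightarrow>
        (let N = (\<Sum>i<m. n i);
             Bs = concat (map (\<lambda>i. replicate (n i) (B i)) [0..<m]);
             D = (\<Pi>\<^sub>E j\<in>{..<N}. Bs ! j);
             M = (\<Pi>\<^sub>M j\<in>{..<N}. disc_measure);
             \<rho> = (\<lambda>x :: nat \<Rightarrow> complex.
                     Determinant.det (Matrix.mat N N (\<lambda>(i, j). K (x i) (x j))));
             F = (\<lambda>X. \<Prod>i<m. falling_factorial (measure X (B i)) (n i))
         in integrable P F \<and> set_integrable M D \<rho> \<and>
            complex_of_real (\<integral>X. F X \<partial>P) = (LINT x:D|M. \<rho> x)))"

(* The sigma-algebra generated by the counts of Borel sets B \<subseteq> C. The counts are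
   ennreal-valued since B need not be relatively compact. *)
definition count_algebra :: "complex set \<Rightarrow> complex measure measure" where
  "count_algebra C =
     sigma Conf {(\<lambda>X. emeasure X B) -` A \<inter> Conf |B A.
                   B \<in> sets borel \<and> B \<subseteq> C \<and> A \<in> sets (borel :: ennreal measure)}"

(* Completion with respect to P adjoins all P-negligible subsets of Conf, i.e. all subsets of
   P-null Borel sets, and not only the subsets of null sets lying in count_algebra C. With the
   latter, smaller, completion no point process whatsoever would be number rigid: members of
   count_algebra C do not see the points in the complement of C. *)
definition completed_count_algebra ::
    "complex measure measure \<Rightarrow> complex set \<Rightarrow> complex measure measure" where
  "completed_count_algebra P C =
     sigma Conf (sets (count_algebra C) \<union> null_sets (completion P))"

definition number_rigid :: "complex measure measure \<Rightarrow> bool" where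
  "number_rigid P \<longleftrightarrow>
     point_process P \<and>
     (\<forall>B. B \<in> sets borel \<longrightarrow> bounded_in_disc B \<longrightarrow>
        (\<lambda>X. emeasure X B) \<in> borel_measurable (completed_count_algebra P (unit_disc - B)))"

end

theory Submission
  imports Defs
begin

text \<open>
  For a bounded set \<open>B\<close> take discs \<open>D\<^sub>j = {\<bar>z\<bar>\<^sup>2 < t\<^sub>j}\<close> containing \<open>B\<close>, with
  \<open>1 - t\<^sub>j\<close> proportional to \<open>2\<^sup>-\<^sup>j\<close>. Since the monomials are orthogonal on
  every disc centred at \<open>0\<close>, the covariance of \<open>#D\<^sub>i\<close> and \<open>#D\<^sub>j\<close> for \<open>i \<le> j\<close>
  is the sum of \<open>t\<^sub>i\<^sup>n\<^sup>+\<^sup>1 (1 - t\<^sub>j\<^sup>n\<^sup>+\<^sup>1)\<close> over \<open>n \<in> \<Lambda>\<close>. As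
  \<open>1 - t\<^sup>n\<^sup>+\<^sup>1 \<le> (n + 1) (1 - t)\<close>, the Bloch condition at the point \<open>t\<^sub>i\<close> bounds it by
  \<open>C (1 - t\<^sub>j) / (1 - t\<^sub>i) = C 2\<^sup>-\<^sup>(\<^sup>j\<^sup>-\<^sup>i\<^sup>)\<close>. Hence the variance of the
  average of \<open>#D\<^sub>0, \<dots>, #D\<^sub>L\<close> is \<open>O(1/L)\<close>, and along a subsequence the centred averages
  tend to \<open>0\<close> almost surely. Since \<open>#D\<^sub>j = #B + #(D\<^sub>j - B)\<close>, this expresses
  \<open>#B\<close> as an almost sure limit of functions of the configuration outside \<open>B\<close>.
\<close>

no_notation vec_index (infixl "$" 100) and fps_nth (infixl "$" 75) and scalar_prod (infix "\<bullet>" 70)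

section \<open>Determinants of order one and two\<close>

lemma det_mat_1: "Determinant.det (Matrix.mat (Suc 0) (Suc 0) f) = f (0,0)" for f :: "nat \<times> nat \<Rightarrow> 'a::comm_ring_1"
  by (subst det_single) auto

lemma det_mat_2:
  fixes f :: "nat \<times> nat \<Rightarrow> 'a::comm_ring_1"
  shows "Determinant.det (Matrix.mat 2 2 f) = f (0,0) * f (1,1) - f (0,1) * f (1,0)" 
proof -
  have "Determinant.det (mat_delete (Matrix.mat 2 2 f) i 0) = f (1 - i, 1)" if "i < 2" for i
    using that by (subst det_single) (auto simp: mat_delete_def less_2_cases_iff)
  then show ?thesis
    by (subst laplace_expansion_column[of _ 2 0]) (auto simp: cofactor_def numeral_2_eq_2)
qed

section \<open>Rotation invariance of area in the plane\<close>

text \<open>The library proves the invariance of Lebesgue measure under orthogonal maps only on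
  \<open>real^'n\<close>, so it is transported to \<^typ>\<open>complex\<close> from \<open>real^2\<close>.\<close>

definition complex_of_vec2 :: "real^2 \<Rightarrow> complex" where "complex_of_vec2 v = Complex (v $ 1) (v $ 2)"

lemma complex_of_vec2_measurable [measurable]: "complex_of_vec2 \<in> borel_measurable borel"
  unfolding complex_of_vec2_def Complex_eq by measurable

text \<open>Boxes pull back to boxes with the same side lengths, and Lebesgue measure is determined
  by its values on boxes.\<close>

lemma distr_complex_of_vec2: "distr lborel borel complex_of_vec2 = (lborel :: complex measure)"
proof (rule sym, rule lborel_eqI)
  fix l u :: complex
  assume "\<And>b. b \<in> Basis \<Longrightarrow> l \<bullet> b \<le> u \<bullet> b"
  then have le: "Re l \<le> Re u" "Im l \<le> Im u"
    by (force simp: Basis_complex_def)+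
  have ord: "vector [Re l, Im l] $ i \<le> (vector [Re u, Im u] :: real^2) $ i" for i
    using le exhaust_2[of i] by auto
  have "complex_of_vec2 -` box l u = box (vector [Re l, Im l]) (vector [Re u, Im u] :: real^2)"
    by (auto simp: complex_of_vec2_def in_box_complex_iff mem_box_cart forall_2)
  then have "emeasure (distr lborel borel complex_of_vec2) (box l u) =
      emeasure lborel (box (vector [Re l, Im l]) (vector [Re u, Im u] :: real^2))"
    by (subst emeasure_distr) auto
  also have "\<dots> = (\<Prod>b\<in>Basis. (vector [Re u, Im u] - vector [Re l, Im l] :: real^2) \<bullet> b)"
    using ord by (subst emeasure_lborel_box) (auto simp: Basis_vec_def inner_axis)
  also have "\<dots> = (\<Prod>b\<in>Basis. (u - l) \<bullet> b)"
    by (simp add: Basis_vec_def Basis_complex_def axis_eq_axis UNION_singleton_eq_range prod.reindex inj_on_def inner_axis UNIV_2 mult.commute)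
  finally show "emeasure (distr lborel borel complex_of_vec2) (box l u) = (\<Prod>b\<in>Basis. (u - l) \<bullet> b)" .
qed simp

lemma orthogonal_transformation_measurable:
  fixes T :: "'a::euclidean_space \<Rightarrow> 'a"
  assumes "orthogonal_transformation T"
  shows "T \<in> borel_measurable borel"
  by (intro borel_measurable_continuous_onI linear_continuous_on)
    (simp add: assms linear_conv_bounded_linear[symmetric] orthogonal_transformation_linear)

text \<open>The preimage of a box under \<open>T\<close> is its image under the inverse of
  \<open>T\<close>, which is again orthogonal and so preserves volume. Agreement on boxes is
  enough.\<close>

lemma distr_lborel_orthogonal:
  fixes T :: "real^'n::{finite,wellorder} \<Rightarrow> real^'n::_"
  assumes T: "orthogonal_transformation T"
  shows "distr lborel borel T = lborel"
proof (rule sym, rule lborel_eqI)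
  fix l u :: "real^'n::_"
  assume le: "\<And>b. b \<in> Basis \<Longrightarrow> l \<bullet> b \<le> u \<bullet> b"
  have [measurable]: "T \<in> borel_measurable borel"
    using T by (rule orthogonal_transformation_measurable)
  have inv: "orthogonal_transformation (inv_into UNIV T)"
    using T by (rule orthogonal_transformation_inv)
  have vim: "T -` box l u = inv_into UNIV T ` box l u"
    by (simp add: T bij_vimage_eq_inv_image orthogonal_transformation_bij)
  have "emeasure (distr lborel borel T) (box l u) = emeasure lebesgue (inv_into UNIV T ` box l u)"
    using measurable_sets_borel[of T borel "box l u"] by (simp add: emeasure_distr vim[symmetric])
  also have "\<dots> = emeasure lebesgue (box l u)"
    using measurable_orthogonal_image[OF inv, of "box l u"] measure_orthogonal_image[OF inv, of "box l u"]
    by (simp add: emeasure_eq_measure2)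
  also have "\<dots> = (\<Prod>b\<in>Basis. (u - l) \<bullet> b)"
    using le by simp
  finally show "emeasure (distr lborel borel T) (box l u) = (\<Prod>b\<in>Basis. (u - l) \<bullet> b)" .
qed simp

lemma distr_lborel_rotation:
  fixes c :: complex
  assumes c: "cmod c = 1"
  shows "distr lborel borel ((*) c) = lborel"
proof -
  \<comment> \<open>Multiplication by \<open>c\<close>, written in real coordinates;
    \<open>complex_of_vec2\<close> intertwines the two maps.\<close>
  define T :: "real^2 \<Rightarrow> real^2" where
    "T v = vector [Re c * v$1 - Im c * v$2, Re c * v$2 + Im c * v$1]" for v
  have c2: "(Re c)\<^sup>2 + (Im c)\<^sup>2 = 1"
    using c by (simp add: cmod_def)
  have "orthogonal_transformation T"
    unfolding orthogonal_transformation
  proof (intro conjI allI)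
    show "linear T"
      by (rule linearI) (auto simp: T_def Finite_Cartesian_Product.vec_eq_iff forall_2 algebra_simps)
    fix v :: "real^2"
    have "(T v $ 1)\<^sup>2 + (T v $ 2)\<^sup>2 = ((Re c)\<^sup>2 + (Im c)\<^sup>2) * ((v$1)\<^sup>2 + (v$2)\<^sup>2)"
      unfolding T_def by (simp add: power2_eq_square algebra_simps)
    then show "norm (T v) = norm v"
      by (simp add: norm_vec_def L2_set_def UNIV_2 c2)
  qed
  then have T: "distr lborel borel T = lborel" and T_meas [measurable]: "T \<in> borel_measurable borel"
    by (rule distr_lborel_orthogonal, rule orthogonal_transformation_measurable)
  have "distr lborel borel ((*) c) = distr (distr lborel borel complex_of_vec2) borel ((*) c)"
    by (simp add: distr_complex_of_vec2)
  also have "\<dots> = distr lborel borel (complex_of_vec2 \<circ> T)"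
    by (subst distr_distr) (auto simp: T_def complex_of_vec2_def complex_eq_iff o_def intro!: arg_cong[where f="distr lborel borel"])
  also have "\<dots> = distr (distr lborel borel T) borel complex_of_vec2"
    by (subst distr_distr) auto
  finally show ?thesis
    by (simp add: T distr_complex_of_vec2)
qed

lemma cnj_measurable [measurable]: "cnj \<in> borel_measurable borel"
  by (intro borel_measurable_continuous_onI continuous_intros)

section \<open>The normalized area measure of the disc\<close>

lemma sets_disc_measure [measurable_cong, simp]: "sets disc_measure = sets borel"
  by (simp add: disc_measure_def)

lemma space_disc_measure [simp]: "space disc_measure = UNIV"
  by (simp add: disc_measure_def)

lemma emeasure_unit_disc: "emeasure lborel unit_disc = ennreal pi"
  by (simp add: emeasure_ball unit_ball_vol_2)

lemma prob_space_disc_measure: "prob_space disc_measure"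
  unfolding disc_measure_def
  by (rule prob_space_uniform_measure) (simp_all add: emeasure_unit_disc)

lemma distr_disc_measure_rotation:
  fixes c :: complex
  assumes c: "cmod c = 1"
  shows "distr disc_measure borel ((*) c) = disc_measure"
proof (rule measure_eqI)
  fix A assume "A \<in> sets (distr disc_measure borel ((*) c))"
  then have [measurable]: "A \<in> sets borel" by simp
  have "emeasure (distr disc_measure borel ((*) c)) A = emeasure disc_measure ((*) c -` A)"
    by (subst emeasure_distr) auto
  also have "\<dots> = emeasure lborel (unit_disc \<inter> (*) c -` A) / emeasure lborel unit_disc"
    unfolding disc_measure_def using measurable_sets_borel[of "(*) c" borel A]
    by (subst emeasure_uniform_measure) auto
  also have "unit_disc \<inter> (*) c -` A = (*) c -` (unit_disc \<inter> A)"
    using c by (auto simp: norm_mult)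
  also have "emeasure lborel \<dots> = emeasure (distr lborel borel ((*) c)) (unit_disc \<inter> A)"
    by (subst emeasure_distr) auto
  also have "\<dots> / emeasure lborel unit_disc = emeasure disc_measure A"
    unfolding disc_measure_def by (simp add: distr_lborel_rotation c)
  finally show "emeasure (distr disc_measure borel ((*) c)) A = emeasure disc_measure A" .
qed simp

text \<open>A disc of radius \<open>sqrt x\<close> has normalized area \<open>x\<close>, so the
  squared modulus is uniformly distributed. It suffices to compare the two measures on upper
  half-lines.\<close>

lemma distr_disc_measure_cmod_square:
  "distr disc_measure borel (\<lambda>z. (cmod z)\<^sup>2) = uniform_measure lborel {0<..<1}"
proof (rule measure_eqI_lessThan)
  interpret prob_space disc_measure by (rule prob_space_disc_measure)
  have le: "emeasure disc_measure {z. (cmod z)\<^sup>2 \<le> x} = ennreal x" if "0 \<le> x" "x < 1" for x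
  proof -
    have "unit_disc \<inter> {z. (cmod z)\<^sup>2 \<le> x} = cball 0 (sqrt x)"
    proof -
      have "cmod z < 1" if "(cmod z)\<^sup>2 \<le> x" for z
        using that \<open>x < 1\<close> by (smt (verit) one_le_power)
      moreover have "cmod z \<le> sqrt x \<longleftrightarrow> (cmod z)\<^sup>2 \<le> x" for z
        using that by (metis abs_norm_cancel real_sqrt_abs real_sqrt_le_iff)
      ultimately show ?thesis by auto
    qed
    moreover have "{z. (cmod z)\<^sup>2 \<le> x} \<in> sets lborel" by measurable
    ultimately show ?thesis
      unfolding disc_measure_def using that
      by (simp add: emeasure_uniform_measure emeasure_unit_disc emeasure_cball unit_ball_vol_2 
          divide_ennreal)
  qed
  show "emeasure (distr disc_measure borel (\<lambda>z. (cmod z)\<^sup>2)) {x<..} < \<infinity>" for x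
    by (subst emeasure_distr) (auto simp: less_top[symmetric])
  show "emeasure (distr disc_measure borel (\<lambda>z. (cmod z)\<^sup>2)) {x<..} =
      emeasure (uniform_measure lborel {0<..<1}) {x<..}" for x
  proof -
    have L: "emeasure (distr disc_measure borel (\<lambda>z. (cmod z)\<^sup>2)) {x<..} =
        emeasure disc_measure {z. x < (cmod z)\<^sup>2}"
      by (subst emeasure_distr) (auto simp: vimage_def)
    have R: "emeasure (uniform_measure lborel {0<..<1}) {x<..} = emeasure lborel ({0<..<1} \<inter> {x<..})"
      by (simp add: divide_ennreal_def)
    consider "x < 0" | "0 \<le> x" "x < 1" | "1 \<le> x" by linarith
    then show ?thesis
    proof cases
      case 1
      then have "{z. x < (cmod z)\<^sup>2} = space disc_measure" "{0<..<1} \<inter> {x<..} = {0<..<1}"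
        by (auto intro: less_le_trans)
      then show ?thesis
        using L R emeasure_space_1 by simp
    next
      case 2
      have "{z. x < (cmod z)\<^sup>2} = space disc_measure - {z. (cmod z)\<^sup>2 \<le> x}"
        by auto
      moreover have "{z. (cmod z)\<^sup>2 \<le> x} \<in> sets disc_measure" by measurable
      ultimately have "emeasure disc_measure {z. x < (cmod z)\<^sup>2} = 1 - ennreal x"
        using emeasure_compl[of "{z. (cmod z)\<^sup>2 \<le> x}" disc_measure] le[OF 2] emeasure_space_1 by simp
      moreover have "{0<..<1} \<inter> {x<..} = {x<..<1}"
        using 2 by auto
      ultimately show ?thesis
        using L R 2 by (simp add: ennreal_minus ennreal_1[symmetric] del: ennreal_1)
    next
      case 3
      have "emeasure disc_measure {z. x < (cmod z)\<^sup>2} = 0"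
      proof -
        have "\<not> (cmod z < 1 \<and> x < (cmod z)\<^sup>2)" for z
          using 3 power_le_one[of "cmod z" 2] by auto
        then have [simp]: "unit_disc \<inter> {z. x < (cmod z)\<^sup>2} = {}"
          by auto
        have "{z. x < (cmod z)\<^sup>2} \<in> sets lborel" by measurable
        then show ?thesis
          unfolding disc_measure_def by (simp add: emeasure_uniform_measure)
      qed
      moreover have "{0<..<1} \<inter> {x<..} = {}"
        using 3 by auto
      ultimately show ?thesis
        using L R by simp
    qed
  qed
qed simp_all

section \<open>Annuli and their moments\<close>

text \<open>The parameters are squared radii, which match the uniform law of the squared modulus.
  The half-open form lets \<open>annulus 0 a\<close> and \<open>annulus a t\<close> partition the
  disc \<open>annulus 0 t\<close> when 0 \<le> a \<le> t.\<close>

definition annulus :: "real \<Rightarrow> real \<Rightarrow> complex set" where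
  "annulus s t = {z. s \<le> (cmod z)\<^sup>2 \<and> (cmod z)\<^sup>2 < t}"

lemma annulus_measurable [measurable]: "annulus s t \<in> sets borel"
  unfolding annulus_def by measurable

text \<open>The integrand depends only on the squared modulus, so the push-forward to the unit
  interval reduces it to the integral of \<open>x ^ n\<close> from \<open>s\<close> to
  \<open>t\<close>.\<close>

lemma annulus_moment_eq:
  assumes "0 \<le> s" "s \<le> t" "t \<le> 1"
  shows "(\<integral>z. indicator (annulus s t) z * (z ^ n * cnj z ^ n) \<partial>disc_measure)
    = of_real ((t ^ Suc n - s ^ Suc n) / Suc n)"
proof -
  have "(\<integral>z. indicator (annulus s t) z * (z ^ n * cnj z ^ n) \<partial>disc_measure)
     = (\<integral>z. of_real (indicator {s..<t} ((cmod z)\<^sup>2) * ((cmod z)\<^sup>2) ^ n) \<partial>disc_measure)"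
    by (intro Bochner_Integration.integral_cong)
      (auto simp: annulus_def indicator_def power_mult_distrib[symmetric] complex_norm_square[symmetric])
  also have "\<dots> = of_real (\<integral>z. indicator {s..<t} ((cmod z)\<^sup>2) * ((cmod z)\<^sup>2) ^ n \<partial>disc_measure)"
    by (rule integral_complex_of_real)
  also have "(\<integral>z. indicator {s..<t} ((cmod z)\<^sup>2) * ((cmod z)\<^sup>2) ^ n \<partial>disc_measure) =
      (\<integral>x. indicator {s..<t} x * x ^ n \<partial>uniform_measure lborel {0<..<1::real})"
    unfolding distr_disc_measure_cmod_square[symmetric] by (subst integral_distr) auto
  also have "\<dots> = (\<integral>x. indicator {0<..<1} x *\<^sub>R (indicator {s..<t} x * x ^ n) \<partial>lborel)"
  proof -
    have "uniform_measure lborel {0<..<1::real} = density lborel (\<lambda>x. ennreal (indicator {0<..<1} x))"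
      by (simp add: uniform_measure_def ennreal_indicator divide_ennreal_def)
    then show ?thesis
      by (subst integral_density[symmetric]) auto
  qed
  \<comment> \<open>The two integrands can differ only at the endpoints \<open>s\<close> and
    \<open>t\<close>, which are null.\<close>
  also have "\<dots> = (\<integral>x. x ^ n * indicator {s..t} x \<partial>lborel)"
  proof (rule integral_cong_AE)
    have "AE x in lborel. x \<noteq> s" "AE x in lborel. x \<noteq> t"
      by (rule AE_lborel_singleton)+
    then show "AE x in lborel. indicator {0<..<1} x *\<^sub>R (indicator {s..<t} x * x ^ n) = x ^ n * indicator {s..t} x"
    proof eventually_elim
      case (elim x)
      then show ?case
        using assms by (auto simp: indicator_def)
    qed
  qed measurable
  also have "\<dots> = (t ^ Suc n - s ^ Suc n) / Suc n"
    using assms by (simp add: integral_power add.commute)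
  finally show ?thesis .
qed

text \<open>A rotation by the angle \<open>\<pi> / \<bar>n - m\<bar>\<close> maps the integral to its negative.\<close>

lemma annulus_moment_neq:
  assumes "n \<noteq> m"
  shows "(\<integral>z. indicator (annulus s t) z * (z ^ n * cnj z ^ m) \<partial>disc_measure) = 0"
    (is "?I = 0")
proof -
  define k where "k = (if m < n then n - m else m - n)"
  have k: "0 < k" using assms by (auto simp: k_def)
  define c where "c = cis (pi / k)"
  have "c ^ k = cis (k * (pi / k))"
    unfolding c_def by (rule Complex.DeMoivre)
  then have c: "cmod c = 1" "c ^ k = -1" "c * cnj c = 1"
    using k by (simp_all add: c_def cis_cnj cis_mult)
  then have c': "cnj c ^ k = -1"
    by (metis complex_cnj_minus complex_cnj_one complex_cnj_power)
  have cc: "c ^ j * cnj c ^ j = 1" for j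
    by (metis c(3) power_mult_distrib power_one)
  \<comment> \<open>Common powers cancel through \<open>c * cnj c = 1\<close>; what remains is the
    \<open>k\<close>-th power of \<open>c\<close> or of its conjugate, and both equal -1.\<close>
  have cnm: "c ^ n * cnj c ^ m = -1"
  proof (cases "m < n")
    case True
    then have "n = m + k" by (simp add: k_def)
    then show ?thesis
      using cc[of m] c by (simp add: power_add algebra_simps)
  next
    case False
    then have "m = n + k" by (simp add: k_def)
    then show ?thesis
      using cc[of n] c' by (simp add: power_add algebra_simps)
  qed
  have "?I = (\<integral>z. indicator (annulus s t) z * (z ^ n * cnj z ^ m) \<partial>distr disc_measure borel ((*) c))"
    by (simp add: distr_disc_measure_rotation c)
  also have "\<dots> = (\<integral>z. indicator (annulus s t) (c * z) * ((c * z) ^ n * cnj (c * z) ^ m) \<partial>disc_measure)"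
    by (subst integral_distr) auto
  also have "\<dots> = (\<integral>z. - (indicator (annulus s t) z * (z ^ n * cnj z ^ m)) \<partial>disc_measure)"
  proof (rule Bochner_Integration.integral_cong)
    fix z
    have "(c * z) ^ n * cnj (c * z) ^ m = (c ^ n * cnj c ^ m) * (z ^ n * cnj z ^ m)"
      by (simp add: power_mult_distrib)
    then show "indicator (annulus s t) (c * z) * ((c * z) ^ n * cnj (c * z) ^ m) =
        - (indicator (annulus s t) z * (z ^ n * cnj z ^ m))"
      by (simp add: cnm annulus_def indicator_def norm_mult c)
  qed simp
  also have "\<dots> = - ?I" by simp
  finally show ?thesis by simp
qed

section \<open>The kernel\<close>

text \<open>The expected number of points of the process in \<open>{z. (cmod z)\<^sup>2 < t}\<close>.\<close>

definition Lsum :: "nat set \<Rightarrow> real \<Rightarrow> real" where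
  "Lsum \<Lambda> t = (\<Sum>n. of_bool (n \<in> \<Lambda>) * t ^ Suc n)"

lemma Lsum_sums:
  assumes "\<bar>t\<bar> < 1"
  shows "(\<lambda>n. of_bool (n \<in> \<Lambda>) * t ^ Suc n) sums Lsum \<Lambda> t"
  unfolding Lsum_def
proof (rule summable_sums, rule summable_comparison_test')
  show "summable (\<lambda>n. \<bar>t\<bar> ^ Suc n)"
    using assms by (simp add: summable_geometric)
  show "norm (of_bool (n \<in> \<Lambda>) * t ^ Suc n) \<le> \<bar>t\<bar> ^ Suc n" for n
    by (simp add: abs_mult power_abs)
qed

lemma Lsum_0 [simp]: "Lsum \<Lambda> 0 = 0"
  by (simp add: Lsum_def)

text \<open>Truncations of the kernel, which can be integrated term by term before passing to the
  limit. The factor \<open>of_bool\<close> turns a sum over \<Lambda> into a series over all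
  indices.\<close>

definition K_partial :: "nat set \<Rightarrow> nat \<Rightarrow> complex \<Rightarrow> complex \<Rightarrow> complex" where
  "K_partial \<Lambda> N z w = (\<Sum>n<N. of_bool (n \<in> \<Lambda>) * of_nat (Suc n) * (z ^ n * cnj w ^ n))"

lemma K_partial_norm_le:
  assumes "cmod z * cmod w \<le> r" "r < 1"
  shows "cmod (of_bool (n \<in> \<Lambda>) * of_nat (Suc n) * (z ^ n * cnj w ^ n)) \<le> real (Suc n) * r ^ n"
proof -
  have "cmod (of_bool (n \<in> \<Lambda>) * of_nat (Suc n) * (z ^ n * cnj w ^ n)) \<le> real (Suc n) * (cmod z * cmod w) ^ n"
    by (simp add: norm_mult norm_power power_mult_distrib del: of_nat_Suc)
  also have "\<dots> \<le> real (Suc n) * r ^ n"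
    using assms by (intro mult_left_mono power_mono) auto
  finally show ?thesis .
qed

text \<open>The bound is the sum of the series of \<open>(n + 1) * r ^ n\<close>. Being independent
  of \<open>N\<close>, it serves as a constant dominating function.\<close>

lemma K_partial_bound:
  assumes "cmod z * cmod w \<le> r" "r < 1"
  shows "cmod (K_partial \<Lambda> N z w) \<le> 1 / (1 - r)\<^sup>2"
proof -
  have r: "0 \<le> r"
    using assms by (meson mult_nonneg_nonneg norm_ge_zero order_trans)
  have sums: "(\<lambda>n. of_nat (Suc n) * r ^ n) sums (1 / (1 - r)\<^sup>2)"
    using r assms(2) by (intro geometric_deriv_sums) auto
  have "cmod (K_partial \<Lambda> N z w) \<le> (\<Sum>n<N. real (Suc n) * r ^ n)"
    unfolding K_partial_def using K_partial_norm_le[OF assms] by (intro sum_norm_le) blast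
  also have "\<dots> \<le> (\<Sum>n. real (Suc n) * r ^ n)"
    using r sums by (intro sum_le_suminf) (auto simp: sums_iff)
  also have "\<dots> = 1 / (1 - r)\<^sup>2"
    using sums by (simp add: sums_iff)
  finally show ?thesis .
qed

text \<open>Absolute convergence identifies the unordered sum over \<Lambda> with the ordered
  series.\<close>

lemma K_partial_tendsto:
  assumes "cmod z < 1" "cmod w < 1"
  shows "(\<lambda>N. K_partial \<Lambda> N z w) \<longlonglongrightarrow> K_Lambda \<Lambda> z w"
proof -
  define r where "r = cmod z * cmod w"
  have r: "0 \<le> r" "r < 1"
    using assms mult_left_le[of "cmod w" "cmod z"] unfolding r_def by auto
  define f where "f n = of_bool (n \<in> \<Lambda>) * of_nat (Suc n) * (z ^ n * cnj w ^ n)" for n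
  have "summable (\<lambda>n. real (Suc n) * r ^ n)"
    using geometric_deriv_sums[of r] r by (auto simp: sums_iff)
  then have norm: "summable (\<lambda>n. norm (f n))"
    by (rule summable_comparison_test'[where N=0])
      (use K_partial_norm_le[of z w r] r in \<open>simp add: f_def r_def\<close>)
  then have sums: "f sums suminf f"
    using summable_norm_cancel summable_sums by blast
  then have "(f has_sum suminf f) UNIV"
    using norm norm_summable_imp_has_sum by blast
  moreover have "(f has_sum S) UNIV \<longleftrightarrow> ((\<lambda>n. of_nat (n + 1) * z ^ n * cnj w ^ n) has_sum S) \<Lambda>" for S
    by (rule has_sum_cong_neutral) (auto simp: f_def)
  ultimately have "K_Lambda \<Lambda> z w = suminf f"
    unfolding K_Lambda_def using infsumI by blast
  then show ?thesis
    using sums unfolding sums_def K_partial_def f_def by simp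
qed

lemma annulus_cmod_less_1:
  assumes "z \<in> annulus s t" "t \<le> 1"
  shows "cmod z < 1"
  using assms by (auto simp: annulus_def) (smt (verit) one_le_power)

text \<open>The inequality of arithmetic and geometric means: \<open>r\<close> bounds both squared
  moduli, hence also the product of the moduli.\<close>

lemma annulus_cmod_mult_le:
  assumes "z \<in> annulus s t" "w \<in> annulus s' t'" "t \<le> r" "t' \<le> r"
  shows "cmod z * cmod w \<le> r"
proof -
  have "2 * (cmod z * cmod w) \<le> (cmod z)\<^sup>2 + (cmod w)\<^sup>2"
    using sum_squares_bound[of "cmod z" "cmod w"] by simp
  also have "\<dots> \<le> 2 * r"
    using assms by (auto simp: annulus_def)
  finally show ?thesis by simp
qed

lemma integrable_annulus_monomial:
  assumes "t \<le> 1"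
  shows "integrable disc_measure (\<lambda>z. indicator (annulus s t) z * (z ^ n * cnj z ^ m) :: complex)"
proof -
  interpret prob_space disc_measure by (rule prob_space_disc_measure)
  have "norm (indicator (annulus s t) z * (z ^ n * cnj z ^ m)) \<le> 1" for z :: complex
    using annulus_cmod_less_1[of z s t] assms
    by (auto simp: indicator_def norm_mult norm_power power_add[symmetric] intro!: power_le_one)
  then show ?thesis
    by (intro integrable_const_bound[where B=1]) auto
qed

text \<open>Dominated convergence reduces the claim to the truncated kernel. There the coefficient
  \<open>n + 1\<close> cancels the denominator of the radial moment, leaving
  \<open>t ^ Suc n - s ^ Suc n\<close>.\<close>

lemma K_diagonal:
  assumes "0 \<le> s" "s \<le> t" "t < 1"
  shows "integrable disc_measure (\<lambda>z. indicator (annulus s t) z * K_Lambda \<Lambda> z z)" (is ?int)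
    and "(\<integral>z. indicator (annulus s t) z * K_Lambda \<Lambda> z z \<partial>disc_measure)
      = of_real (Lsum \<Lambda> t - Lsum \<Lambda> s)"
proof -
  interpret prob_space disc_measure by (rule prob_space_disc_measure)
  define u where "u N z = indicator (annulus s t) z * K_partial \<Lambda> N z z" for N z
  have meas [measurable]: "u N \<in> borel_measurable disc_measure" for N
    unfolding u_def K_partial_def by measurable
  have lim: "(\<lambda>N. u N z) \<longlonglongrightarrow> indicator (annulus s t) z * K_Lambda \<Lambda> z z" for z
    using assms annulus_cmod_less_1[of z s t]
    by (auto simp: u_def indicator_def intro!: K_partial_tendsto)
  have [measurable]: "(\<lambda>z. indicator (annulus s t) z * K_Lambda \<Lambda> z z) \<in> borel_measurable disc_measure"
    using lim by (rule borel_measurable_LIMSEQ_metric[OF meas])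
  have bound: "norm (u N z) \<le> 1 / (1 - t)\<^sup>2" for N z
    using assms annulus_cmod_mult_le[of z s t z s t t] K_partial_bound[of z z t]
    by (auto simp: u_def indicator_def)
  note dom = lim[THEN AE_I2] bound[THEN AE_I2]
  show ?int
    by (rule integrable_dominated_convergence[where s=u and w="\<lambda>_. 1 / (1 - t)\<^sup>2"])
      (use dom in auto)
  have "(\<lambda>N. integral\<^sup>L disc_measure (u N)) \<longlonglongrightarrow>
      (\<integral>z. indicator (annulus s t) z * K_Lambda \<Lambda> z z \<partial>disc_measure)"
    by (rule integral_dominated_convergence[where w="\<lambda>_. 1 / (1 - t)\<^sup>2"])
      (use dom in auto)
  moreover have "integral\<^sup>L disc_measure (u N) =
      of_real (\<Sum>n<N. of_bool (n \<in> \<Lambda>) * t ^ Suc n - of_bool (n \<in> \<Lambda>) * s ^ Suc n)" for N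
  proof -
    have "integral\<^sup>L disc_measure (u N) = (\<integral>z. (\<Sum>n<N. of_bool (n \<in> \<Lambda>) * of_nat (Suc n) *
        (indicator (annulus s t) z * (z ^ n * cnj z ^ n))) \<partial>disc_measure)"
      unfolding u_def K_partial_def
      by (intro Bochner_Integration.integral_cong) (auto simp: sum_distrib_left mult_ac)
    also have "\<dots> = (\<Sum>n<N. of_bool (n \<in> \<Lambda>) * of_nat (Suc n) * of_real ((t ^ Suc n - s ^ Suc n) / Suc n))"
      using assms integrable_annulus_monomial[of t s]
      by (subst Bochner_Integration.integral_sum) (auto simp: annulus_moment_eq simp del: of_nat_Suc power_Suc)
    also have "\<dots> = of_real (\<Sum>n<N. of_bool (n \<in> \<Lambda>) * t ^ Suc n - of_bool (n \<in> \<Lambda>) * s ^ Suc n)"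
      unfolding of_real_sum
    proof (intro sum.cong refl)
      fix n
      show "of_bool (n \<in> \<Lambda>) * of_nat (Suc n) * of_real ((t ^ Suc n - s ^ Suc n) / Suc n) =
          complex_of_real (of_bool (n \<in> \<Lambda>) * t ^ Suc n - of_bool (n \<in> \<Lambda>) * s ^ Suc n)"
        by (cases "n \<in> \<Lambda>") (simp_all del: of_nat_Suc power_Suc)
    qed
    finally show ?thesis .
  qed
  moreover have "(\<lambda>N. complex_of_real (\<Sum>n<N. of_bool (n \<in> \<Lambda>) * t ^ Suc n - of_bool (n \<in> \<Lambda>) * s ^ Suc n))
      \<longlonglongrightarrow> of_real (Lsum \<Lambda> t - Lsum \<Lambda> s)"
    using assms sums_diff[OF Lsum_sums[of t \<Lambda>] Lsum_sums[of s \<Lambda>]]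
    unfolding sums_def by (intro tendsto_of_real) auto
  ultimately show "(\<integral>z. indicator (annulus s t) z * K_Lambda \<Lambda> z z \<partial>disc_measure)
      = of_real (Lsum \<Lambda> t - Lsum \<Lambda> s)"
    by (simp add: LIMSEQ_unique)
qed

section \<open>Integrals over one and two points\<close>

lemma integral_PiM_disc_1:
  assumes "f \<in> borel_measurable disc_measure"
  shows "(\<integral>x. f (x 0) \<partial>(\<Pi>\<^sub>M j\<in>{..<Suc 0}. disc_measure)) = (integral\<^sup>L disc_measure f :: complex)"
proof -
  interpret product_prob_space "\<lambda>_::nat. disc_measure"
    by (simp add: product_prob_space_def product_prob_space_axioms_def product_sigma_finite_def
        prob_space_disc_measure prob_space_imp_sigma_finite)
  show ?thesis
    using product_integral_singleton[of f 0] assms by (simp add: lessThan_Suc)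
qed

lemma integral_PiM_disc_2:
  fixes f g :: "complex \<Rightarrow> complex"
  assumes "integrable disc_measure f" "integrable disc_measure g"
  shows "integrable (\<Pi>\<^sub>M j\<in>{..<2::nat}. disc_measure) (\<lambda>x. f (x 0) * g (x 1))" (is ?int)
    and "(\<integral>x. f (x 0) * g (x 1) \<partial>(\<Pi>\<^sub>M j\<in>{..<2::nat}. disc_measure)) =
      integral\<^sup>L disc_measure f * integral\<^sup>L disc_measure g"
proof -
  interpret product_prob_space "\<lambda>_::nat. disc_measure"
    by (simp add: product_prob_space_def product_prob_space_axioms_def product_sigma_finite_def
        prob_space_disc_measure prob_space_imp_sigma_finite)
  define h where "h i = (if i = 0 then f else g)" for i :: nat
  have 2: "{..<2::nat} = {0, 1}" by auto
  have h: "integrable disc_measure (h i)" for i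
    using assms by (simp add: h_def)
  show ?int
    using product_integrable_prod[of "{..<2}" h] h by (simp add: h_def 2)
  show "(\<integral>x. f (x 0) * g (x 1) \<partial>(\<Pi>\<^sub>M j\<in>{..<2::nat}. disc_measure)) =
      integral\<^sup>L disc_measure f * integral\<^sup>L disc_measure g"
    using product_integral_prod[of "{..<2}" h] h by (simp add: h_def 2)
qed

text \<open>Orthogonality of the monomials removes the cross terms of the double sum. In the
  diagonal terms the two coefficients \<open>n + 1\<close> cancel the denominators of the two
  moments, and the powers of \<open>a\<close> combine with those of \<open>t\<close> and
  \<open>s\<close>.\<close>

lemma K_off_diagonal:
  fixes \<Lambda> :: "nat set"
  assumes a: "0 \<le> a" "a < 1" and st: "0 \<le> s" "s \<le> t" "t < 1"
  defines "F \<equiv> \<lambda>x :: nat \<Rightarrow> complex. indicator (annulus 0 a) (x 0) * indicator (annulus s t) (x 1) *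
    (K_Lambda \<Lambda> (x 0) (x 1) * K_Lambda \<Lambda> (x 1) (x 0))"
  shows "integrable (\<Pi>\<^sub>M j\<in>{..<2}. disc_measure) F" (is ?int)
    and "integral\<^sup>L (\<Pi>\<^sub>M j\<in>{..<2}. disc_measure) F = of_real (Lsum \<Lambda> (a * t) - Lsum \<Lambda> (a * s))"
proof -
  let ?M = "\<Pi>\<^sub>M j\<in>{..<2::nat}. disc_measure"
  interpret prob_space ?M
    by (intro prob_space_PiM prob_space_disc_measure)
  \<comment> \<open>A common bound for both squared radii, so that one constant dominates both
    kernel factors.\<close>
  define r where "r = max a t"
  have r: "a \<le> r" "t \<le> r" "r < 1"
    using a st by (auto simp: r_def)
  have [measurable]: "(\<lambda>x. x 0) \<in> borel_measurable ?M" "(\<lambda>x. x 1) \<in> borel_measurable ?M"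
    using measurable_component_singleton[of 0 "{..<2}" "\<lambda>_. disc_measure"]
      measurable_component_singleton[of 1 "{..<2}" "\<lambda>_. disc_measure"]
    by (simp_all add: measurable_cong_sets[OF refl sets_disc_measure])
  define u where "u N x = indicator (annulus 0 a) (x 0) * indicator (annulus s t) (x 1) *
    (K_partial \<Lambda> N (x 0) (x 1) * K_partial \<Lambda> N (x 1) (x 0))" for N and x :: "nat \<Rightarrow> complex"
  have meas [measurable]: "u N \<in> borel_measurable ?M" for N
    unfolding u_def K_partial_def by measurable
  have lim: "(\<lambda>N. u N x) \<longlonglongrightarrow> F x" for x
    using a st annulus_cmod_less_1[of "x 0" 0 a] annulus_cmod_less_1[of "x 1" s t]
    by (auto simp: u_def F_def indicator_def intro!: K_partial_tendsto tendsto_mult)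
  have [measurable]: "F \<in> borel_measurable ?M"
    using lim by (rule borel_measurable_LIMSEQ_metric[OF meas])
  have bound: "norm (u N x) \<le> 1 / (1 - r)\<^sup>2 * (1 / (1 - r)\<^sup>2)" for N x
  proof (cases "x 0 \<in> annulus 0 a \<and> x 1 \<in> annulus s t")
    case True
    then have "cmod (x 0) * cmod (x 1) \<le> r"
      using annulus_cmod_mult_le r by blast
    moreover from this have "cmod (x 1) * cmod (x 0) \<le> r"
      by (simp add: mult.commute)
    ultimately show ?thesis
      using True r by (auto simp: u_def norm_mult simp del: times_divide_eq_left times_divide_eq_right
          intro!: mult_mono K_partial_bound)
  qed (auto simp: u_def)
  note dom = lim[THEN AE_I2] bound[THEN AE_I2]
  show ?int
    by (rule integrable_dominated_convergence[where s=u and w="\<lambda>_. 1 / (1 - r)\<^sup>2 * (1 / (1 - r)\<^sup>2)"])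
      (use dom in \<open>auto simp del: times_divide_eq_left times_divide_eq_right\<close>)
  have "(\<lambda>N. integral\<^sup>L ?M (u N)) \<longlonglongrightarrow> integral\<^sup>L ?M F"
    by (rule integral_dominated_convergence[where w="\<lambda>_. 1 / (1 - r)\<^sup>2 * (1 / (1 - r)\<^sup>2)"])
      (use dom in \<open>auto simp del: times_divide_eq_left times_divide_eq_right\<close>)
  moreover have "integral\<^sup>L ?M (u N) =
      of_real (\<Sum>n<N. of_bool (n \<in> \<Lambda>) * (a * t) ^ Suc n - of_bool (n \<in> \<Lambda>) * (a * s) ^ Suc n)" for N
  proof -
    define c where "c n = (of_bool (n \<in> \<Lambda>) * of_nat (Suc n) :: complex)" for n
    define f where "f k l z = (indicator (annulus 0 a) z * (z ^ k * cnj z ^ l) :: complex)" for k l z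
    define g where "g k l z = (indicator (annulus s t) z * (z ^ k * cnj z ^ l) :: complex)" for k l z
    have int: "integrable disc_measure (f k l)" "integrable disc_measure (g k l)" for k l
      using a st unfolding f_def g_def by (auto intro: integrable_annulus_monomial)
    have f: "integral\<^sup>L disc_measure (f k l) = (if k = l then of_real (a ^ Suc k / Suc k) else 0)" for k l
      using a annulus_moment_eq[of 0 a k] annulus_moment_neq[of k l 0 a]
      unfolding f_def by (auto simp del: of_nat_Suc)
    have g: "integral\<^sup>L disc_measure (g k l) = (if k = l then of_real ((t ^ Suc k - s ^ Suc k) / Suc k) else 0)" for k l
      using st annulus_moment_eq[of s t k] annulus_moment_neq[of k l s t]
      unfolding g_def by auto
    \<comment> \<open>The arguments of the second kernel are exchanged: the first point carries the
      exponents \<open>k\<close>, \<open>l\<close> and the second \<open>l\<close>,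
      \<open>k\<close>.\<close>
    have "u N = (\<lambda>x. \<Sum>k<N. \<Sum>l<N. c k * c l * (f k l (x 0) * g l k (x 1)))"
    proof
      fix x :: "nat \<Rightarrow> complex"
      have "K_partial \<Lambda> N (x 0) (x 1) * K_partial \<Lambda> N (x 1) (x 0) = (\<Sum>k<N. \<Sum>l<N.
          c k * (x 0 ^ k * cnj (x 1) ^ k) * (c l * (x 1 ^ l * cnj (x 0) ^ l)))"
        unfolding K_partial_def c_def[symmetric] sum_product ..
      then show "u N x = (\<Sum>k<N. \<Sum>l<N. c k * c l * (f k l (x 0) * g l k (x 1)))"
        by (auto simp: u_def f_def g_def mult_ac sum_distrib_left intro!: sum.cong)
    qed
    then have "integral\<^sup>L ?M (u N) =
        (\<Sum>k<N. \<Sum>l<N. c k * c l * (integral\<^sup>L disc_measure (f k l) * integral\<^sup>L disc_measure (g l k)))"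
      using integral_PiM_disc_2[OF int(1) int(2)]
      by (subst Bochner_Integration.integral_sum | subst Bochner_Integration.integral_mult_right_zero
          | auto intro!: Bochner_Integration.integrable_sum integrable_mult_right sum.cong)+
    also have "\<dots> = (\<Sum>k<N. c k * c k * of_real (a ^ Suc k / Suc k * ((t ^ Suc k - s ^ Suc k) / Suc k)))"
      by (intro sum.cong) (auto simp: f g if_distrib if_distribR cong: if_cong)
    also have "\<dots> = of_real (\<Sum>n<N. of_bool (n \<in> \<Lambda>) * (a * t) ^ Suc n - of_bool (n \<in> \<Lambda>) * (a * s) ^ Suc n)"
      by (auto simp: c_def power_mult_distrib right_diff_distrib diff_divide_distrib simp del: of_nat_Suc power_Suc intro!: sum.cong)
    finally show ?thesis .
  qed
  moreover have "(\<lambda>N. complex_of_real (\<Sum>n<N. of_bool (n \<in> \<Lambda>) * (a * t) ^ Suc n - of_bool (n \<in> \<Lambda>) * (a * s) ^ Suc n))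
      \<longlonglongrightarrow> of_real (Lsum \<Lambda> (a * t) - Lsum \<Lambda> (a * s))"
  proof -
    have "\<bar>a * t\<bar> < 1" "\<bar>a * s\<bar> < 1"
      using a st mult_left_le[of t a] mult_left_le[of s a] by auto
    then show ?thesis
      using sums_diff[OF Lsum_sums[of "a * t" \<Lambda>] Lsum_sums[of "a * s" \<Lambda>]]
      unfolding sums_def by (intro tendsto_of_real) auto
  qed
  ultimately show "integral\<^sup>L ?M F = of_real (Lsum \<Lambda> (a * t) - Lsum \<Lambda> (a * s))"
    by (simp add: LIMSEQ_unique)
qed

section \<open>Moments of the counts\<close>

lemma bounded_in_disc_subset:
  assumes "A \<subseteq> cball 0 r" "r < 1"
  shows "bounded_in_disc A"
proof -
  have "closure A \<subseteq> cball 0 r"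
    using assms by (simp add: closure_minimal)
  moreover from this have "bounded (closure A)"
    using bounded_cball bounded_subset by blast
  ultimately show ?thesis
    using assms by (auto simp: bounded_in_disc_def compact_eq_bounded_closed)
qed

lemma bounded_in_disc_annulus:
  assumes "t < 1"
  shows "bounded_in_disc (annulus s t)"
proof (rule bounded_in_disc_subset)
  show "annulus s t \<subseteq> cball 0 (sqrt (max t 0))"
    by (auto simp: annulus_def real_le_rsqrt)
  show "sqrt (max t 0) < 1"
    using assms by auto
qed

text \<open>\<open>N\<close> and \<open>Bs\<close> enter through equations, so that instances can
  use literals such as \<open>2\<close> and \<open>[A, A]\<close> in place of the sum and the
  concatenation.\<close>

lemma determinantalD:
  fixes m :: nat and B :: "nat \<Rightarrow> complex set" and n :: "nat \<Rightarrow> nat"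
  assumes "determinantal P K" "1 \<le> m"
    "\<And>i. i < m \<Longrightarrow> B i \<in> sets borel \<and> bounded_in_disc (B i)"
    "disjoint_family_on B {..<m}" "\<And>i. i < m \<Longrightarrow> 1 \<le> n i"
    and N: "N = (\<Sum>i<m. n i)"
    and Bs: "Bs = concat (map (\<lambda>i. replicate (n i) (B i)) [0..<m])"
  shows "integrable P (\<lambda>X. \<Prod>i<m. falling_factorial (measure X (B i)) (n i))"
    and "complex_of_real (\<integral>X. (\<Prod>i<m. falling_factorial (measure X (B i)) (n i)) \<partial>P) =
      (LINT x:(\<Pi>\<^sub>E j\<in>{..<N}. Bs ! j)|(\<Pi>\<^sub>M j\<in>{..<N}. disc_measure).
        Determinant.det (Matrix.mat N N (\<lambda>(i, j). K (x i) (x j))))"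
  using assms(1)[unfolded determinantal_def Let_def, THEN conjunct2, rule_format, of m B n] assms(2-5)
  unfolding N Bs by auto

text \<open>The first factorial moment: a single block of multiplicity one, whose determinant is the
  kernel on the diagonal.\<close>

lemma determinantal_mean:
  assumes P: "determinantal P (K_Lambda \<Lambda>)" and st: "0 \<le> s" "s \<le> t" "t < 1"
  shows "integrable P (\<lambda>X. measure X (annulus s t))"
    and "(\<integral>X. measure X (annulus s t) \<partial>P) = Lsum \<Lambda> t - Lsum \<Lambda> s"
proof -
  let ?A = "annulus s t"
  note * = determinantalD[OF P, of 1 "\<lambda>_. ?A" "\<lambda>_. 1" 1 "[?A]"]
  have d: "Determinant.det (Matrix.mat (Suc 0) (Suc 0) (\<lambda>(i, j). K_Lambda \<Lambda> (x i) (x j))) =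
     K_Lambda \<Lambda> (x 0) (x 0)" for x :: "nat \<Rightarrow> complex"
    by (simp add: det_mat_1)
  show "integrable P (\<lambda>X. measure X (annulus s t))"
    using *(1) st bounded_in_disc_annulus[of t s] 
    by (simp add: disjoint_family_on_def falling_factorial_def)
  have "complex_of_real (\<integral>X. measure X ?A \<partial>P) =
      (LINT x:(\<Pi>\<^sub>E j\<in>{..<Suc 0}. [?A] ! j)|(\<Pi>\<^sub>M j\<in>{..<Suc 0}. disc_measure).
        Determinant.det (Matrix.mat (Suc 0) (Suc 0) (\<lambda>(i, j). K_Lambda \<Lambda> (x i) (x j))))"
    using *(2) st bounded_in_disc_annulus[of t s] 
    by (simp add: disjoint_family_on_def falling_factorial_def)
  also have "\<dots> = (\<integral>x. indicator ?A (x 0) * K_Lambda \<Lambda> (x 0) (x 0) \<partial>(\<Pi>\<^sub>M j\<in>{..<Suc 0}. disc_measure))"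
    unfolding set_lebesgue_integral_def d
    by (intro Bochner_Integration.integral_cong)
      (auto simp: space_PiM PiE_iff indicator_def)
  also have "\<dots> = of_real (Lsum \<Lambda> t - Lsum \<Lambda> s)"
    using K_diagonal[OF st] by (subst integral_PiM_disc_1) auto
  finally show "(\<integral>X. measure X (annulus s t) \<partial>P) = Lsum \<Lambda> t - Lsum \<Lambda> s"
    using of_real_eq_iff by blast
qed

text \<open>The diagonal product of the determinant factorizes into two means, and the other product
  is the off-diagonal integral. The two regions may overlap, so the case of equal discs is
  included.\<close>

lemma integral_det_2:
  assumes a: "0 \<le> a" "a < 1" and st: "0 \<le> s" "s \<le> t" "t < 1"
  shows "(LINT x:(\<Pi>\<^sub>E j\<in>{..<2}. [annulus 0 a, annulus s t] ! j)|(\<Pi>\<^sub>M j\<in>{..<2::nat}. disc_measure).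
        Determinant.det (Matrix.mat 2 2 (\<lambda>(i, j). K_Lambda \<Lambda> (x i) (x j)))) =
    of_real (Lsum \<Lambda> a * (Lsum \<Lambda> t - Lsum \<Lambda> s) - (Lsum \<Lambda> (a * t) - Lsum \<Lambda> (a * s)))"
proof -
  let ?U = "annulus 0 a" and ?V = "annulus s t" and ?M = "\<Pi>\<^sub>M j\<in>{..<2::nat}. disc_measure"
  define f where "f z = indicator ?U z * K_Lambda \<Lambda> z z" for z
  define g where "g z = indicator ?V z * K_Lambda \<Lambda> z z" for z
  note f = K_diagonal[of 0 a \<Lambda>, folded f_def] and g = K_diagonal[of s t \<Lambda>, folded g_def]
  note fg = integral_PiM_disc_2[of f g]
  note K = K_off_diagonal[of a s t \<Lambda>]
  have d: "Determinant.det (Matrix.mat 2 2 (\<lambda>(i, j). K_Lambda \<Lambda> (x i) (x j))) =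
     K_Lambda \<Lambda> (x 0) (x 0) * K_Lambda \<Lambda> (x 1) (x 1) - K_Lambda \<Lambda> (x 0) (x 1) * K_Lambda \<Lambda> (x 1) (x 0)"
    for x :: "nat \<Rightarrow> complex"
    by (simp add: det_mat_2)
  have "(LINT x:(\<Pi>\<^sub>E j\<in>{..<2}. [?U, ?V] ! j)|?M.
        Determinant.det (Matrix.mat 2 2 (\<lambda>(i, j). K_Lambda \<Lambda> (x i) (x j)))) =
      (\<integral>x. f (x 0) * g (x 1) - indicator ?U (x 0) * indicator ?V (x 1) *
        (K_Lambda \<Lambda> (x 0) (x 1) * K_Lambda \<Lambda> (x 1) (x 0)) \<partial>?M)"
    unfolding set_lebesgue_integral_def d
  proof (intro Bochner_Integration.integral_cong refl)
    fix x assume "x \<in> space ?M"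
    then have "x \<in> extensional {..<2}"
      by (simp add: space_PiM PiE_def)
    \<comment> \<open>Points of the product space are extensional, so membership in the box only
      concerns the two coordinates.\<close>
    then have "x \<in> (\<Pi>\<^sub>E j\<in>{..<2}. [?U, ?V] ! j) \<longleftrightarrow> x 0 \<in> ?U \<and> x 1 \<in> ?V"
      by (simp add: PiE_iff lessThan_Suc numeral_2_eq_2) (auto simp: extensional_def)
    then show "indicator (\<Pi>\<^sub>E j\<in>{..<2}. [?U, ?V] ! j) x *\<^sub>R
        (K_Lambda \<Lambda> (x 0) (x 0) * K_Lambda \<Lambda> (x 1) (x 1) - K_Lambda \<Lambda> (x 0) (x 1) * K_Lambda \<Lambda> (x 1) (x 0)) =
      f (x 0) * g (x 1) - indicator ?U (x 0) * indicator ?V (x 1) *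
        (K_Lambda \<Lambda> (x 0) (x 1) * K_Lambda \<Lambda> (x 1) (x 0))"
      by (auto simp: f_def g_def indicator_def)
  qed
  also have "\<dots> = integral\<^sup>L disc_measure f * integral\<^sup>L disc_measure g
      - of_real (Lsum \<Lambda> (a * t) - Lsum \<Lambda> (a * s))"
    using fg f g K a st by simp
  finally show ?thesis
    using f g a st by simp
qed

section \<open>Averages of weakly correlated variables\<close>

text \<open>Passing from \<open>L\<close> to \<open>Suc L\<close> halves the old sum and adds one
  term 1/2.\<close>

lemma geometric_half_sum_le:
  "(\<Sum>i<L. (1/2) ^ (L - i)) \<le> (1::real)"
proof (induction L)
  case (Suc L)
  have "(\<Sum>i<Suc L. (1/2) ^ (Suc L - i)) = (\<Sum>i<L. (1/2) * (1/2) ^ (L - i)) + (1/2::real)"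
    by (auto simp: Suc_diff_le intro!: sum.cong)
  also have "\<dots> = (1/2) * (\<Sum>i<L. (1/2) ^ (L - i)) + 1/2"
    by (simp only: sum_distrib_left)
  finally show ?case
    using Suc by simp
qed simp

text \<open>Each new variable adds at most 3C: twice its products with the earlier variables, which
  total at most C by the geometric decay, and at most C for its own square.\<close>

lemma second_moment_sum_le:
  fixes u :: "nat \<Rightarrow> 'a \<Rightarrow> real"
  assumes int: "\<And>i j. integrable M (\<lambda>x. u i x * u j x)"
    and le: "\<And>i j. i \<le> j \<Longrightarrow> (\<integral>x. u i x * u j x \<partial>M) \<le> C * (1/2) ^ (j - i)"
    and C: "0 \<le> C"
  shows "integrable M (\<lambda>x. (\<Sum>j<L. u j x)\<^sup>2)"
    and "(\<integral>x. (\<Sum>j<L. u j x)\<^sup>2 \<partial>M) \<le> 3 * C * real L"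
proof -
  show int': "integrable M (\<lambda>x. (\<Sum>j<L. u j x)\<^sup>2)" for L
    using int by (simp add: power2_eq_square sum_product)
  show "(\<integral>x. (\<Sum>j<L. u j x)\<^sup>2 \<partial>M) \<le> 3 * C * real L"
  proof (induction L)
    case (Suc L)
    have "(\<integral>x. (\<Sum>j<Suc L. u j x)\<^sup>2 \<partial>M) =
        (\<integral>x. (\<Sum>j<L. u j x)\<^sup>2 + 2 * (\<Sum>j<L. u j x * u L x) + u L x * u L x \<partial>M)"
      by (intro Bochner_Integration.integral_cong)
        (auto simp: power2_eq_square algebra_simps sum_distrib_left sum_distrib_right)
    also have "\<dots> = (\<integral>x. (\<Sum>j<L. u j x)\<^sup>2 \<partial>M) + 2 * (\<Sum>j<L. \<integral>x. u j x * u L x \<partial>M)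
        + (\<integral>x. u L x * u L x \<partial>M)"
      using int int' by simp
    also have "\<dots> \<le> 3 * C * real L + 2 * (\<Sum>j<L. C * (1/2) ^ (L - j)) + C"
      using Suc le le[of L L] by (intro add_mono mult_left_mono sum_mono) auto
    also have "(\<Sum>j<L. C * (1/2) ^ (L - j)) = C * (\<Sum>j<L. (1/2) ^ (L - j))"
      by (rule sum_distrib_left[symmetric])
    also have "\<dots> \<le> C * 1"
      using C by (intro mult_left_mono geometric_half_sum_le)
    finally show ?case
      by (simp add: algebra_simps)
  qed simp
qed

text \<open>The second moment of the average of \<open>Suc L\<close> variables is at most
  \<open>3 * C / Suc L\<close>, so the averages tend to 0 in mean square, and a subsequence does so
  almost everywhere.\<close>

lemma average_AE_subseq_tendsto_0:
  fixes u :: "nat \<Rightarrow> 'a \<Rightarrow> real"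
  assumes int: "\<And>i j. integrable M (\<lambda>x. u i x * u j x)"
    and le: "\<And>i j. i \<le> j \<Longrightarrow> (\<integral>x. u i x * u j x \<partial>M) \<le> C * (1/2) ^ (j - i)"
    and C: "0 \<le> C"
  shows "\<exists>r :: nat \<Rightarrow> nat. AE x in M. (\<lambda>k. (\<Sum>j<Suc (r k). u j x) / real (Suc (r k))) \<longlonglongrightarrow> 0"
proof -
  \<comment> \<open>Mean square convergence of the averages is L1 convergence of their squares
    \<open>w\<close>. Using \<open>Suc L\<close> keeps the denominator positive.\<close>
  define w where "w L x = ((\<Sum>j<Suc L. u j x) / real (Suc L))\<^sup>2" for L x
  note S = second_moment_sum_le[OF assms]
  have int_w: "integrable M (w L)" for L
    unfolding w_def power_divide using S(1)[of "Suc L"] by (rule integrable_divide)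
  have "(\<integral>x. norm (w L x) \<partial>M) \<le> 3 * C / real (Suc L)" for L
  proof -
    have "(\<integral>x. norm (w L x) \<partial>M) = (\<integral>x. (\<Sum>j<Suc L. u j x)\<^sup>2 \<partial>M) / (real (Suc L))\<^sup>2"
      by (simp add: w_def power_divide del: sum.lessThan_Suc of_nat_Suc)
    also have "\<dots> \<le> (3 * C * real (Suc L)) / (real (Suc L))\<^sup>2"
      by (intro divide_right_mono S zero_le_power2)
    finally show ?thesis
      by (simp add: power2_eq_square del: of_nat_Suc)
  qed
  then have upper: "\<forall>\<^sub>F L in sequentially. (\<integral>x. norm (w L x) \<partial>M) \<le> 3 * C / real (Suc L)"
    by (rule always_eventually[OF allI])
  have lower: "\<forall>\<^sub>F L in sequentially. 0 \<le> (\<integral>x. norm (w L x) \<partial>M)"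
    by (rule always_eventually[OF allI]) simp
  have "(\<lambda>L. 3 * C / real (Suc L)) \<longlonglongrightarrow> 0"
    by real_asymp
  then have "(\<lambda>L. \<integral>x. norm (w L x) \<partial>M) \<longlonglongrightarrow> 0"
    by (rule tendsto_sandwich[OF lower upper tendsto_const])
  then obtain r where r: "AE x in M. (\<lambda>k. w (r k) x) \<longlonglongrightarrow> 0"
    using tendsto_L1_AE_subseq[of M w, OF int_w] by blast
  have "AE x in M. (\<lambda>k. (\<Sum>j<Suc (r k). u j x) / real (Suc (r k))) \<longlonglongrightarrow> 0"
    using r
  proof eventually_elim
    case (elim x)
    then have "(\<lambda>k. sqrt (w (r k) x)) \<longlonglongrightarrow> 0"
      using tendsto_real_sqrt[of "\<lambda>k. w (r k) x" 0] by simp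
    then show ?case
      unfolding w_def real_sqrt_abs by (rule tendsto_rabs_zero_cancel)
  qed
  then show ?thesis
    by (rule exI[of _ r])
qed

section \<open>The Bloch condition\<close>

text \<open>Gives the form as a power series to which termwise differentiation applies.\<close>

lemma f_Lambda_eq_suminf:
  assumes "cmod z < 1"
  shows "f_Lambda \<Lambda> z = (\<Sum>n. of_bool (n \<in> \<Lambda>) * z ^ n)"
proof -
  define f where "f n = of_bool (n \<in> \<Lambda>) * z ^ n" for n
  have norm: "summable (\<lambda>n. norm (f n))"
    by (rule summable_comparison_test'[OF summable_geometric[of "cmod z"], where N=0])
      (use assms in \<open>auto simp: f_def norm_mult norm_power\<close>)
  then have "f sums suminf f"
    using summable_norm_cancel summable_sums by blast
  then have "(f has_sum suminf f) UNIV"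
    using norm norm_summable_imp_has_sum by blast
  moreover have "(f has_sum S) UNIV \<longleftrightarrow> ((\<lambda>n. z ^ n) has_sum S) \<Lambda>" for S
    by (rule has_sum_cong_neutral) (auto simp: f_def)
  ultimately show ?thesis
    unfolding f_Lambda_def f_def using infsumI by blast
qed

lemma deriv_f_Lambda_sums:
  assumes "cmod z < 1"
  shows "(\<lambda>n. of_nat (Suc n) * of_bool (Suc n \<in> \<Lambda>) * z ^ n) sums deriv (f_Lambda \<Lambda>) z"
proof -
  define c :: "nat \<Rightarrow> complex" where "c n = of_bool (n \<in> \<Lambda>)" for n
  have c: "summable (\<lambda>n. c n * w ^ n)" if "cmod w < 1" for w
    by (rule summable_norm_cancel, rule summable_comparison_test'[OF summable_geometric[of "cmod w"], where N=0])
      (use that in \<open>auto simp: c_def norm_mult norm_power\<close>)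
  have "((\<lambda>w. \<Sum>n. c n * w ^ n) has_field_derivative (\<Sum>n. diffs c n * z ^ n)) (at z)"
    using c assms by (intro termdiffs_strong'[where K=1]) auto
  then have "(f_Lambda \<Lambda> has_field_derivative (\<Sum>n. diffs c n * z ^ n)) (at z)"
    by (rule has_field_derivative_transform_within_open[where S="ball 0 1"])
      (use assms in \<open>auto simp: f_Lambda_eq_suminf c_def\<close>)
  then have "deriv (f_Lambda \<Lambda>) z = (\<Sum>n. diffs c n * z ^ n)"
    by (rule DERIV_imp_deriv)
  moreover have "summable (\<lambda>n. diffs c n * z ^ n)"
    using c assms by (intro termdiff_converges[where K=1]) auto
  ultimately show ?thesis
    by (simp add: sums_iff diffs_def c_def)
qed

text \<open>At a real point of [0, 1) the derivative series has non-negative terms, so its partial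
  sums are bounded by the Bloch condition. The rest adapts its weights to those of the covariance
  formula.\<close>

lemma bloch_partial_sum_le:
  assumes "f_Lambda \<Lambda> \<in> bloch_space"
  obtains C where "0 \<le> C"
    "\<And>t N. 0 \<le> t \<Longrightarrow> t < 1 \<Longrightarrow> (\<Sum>n<N. of_bool (n \<in> \<Lambda>) * (real (Suc n) * t ^ Suc n)) \<le> C / (1 - t)"
proof -
  have "bdd_above ((\<lambda>z. (1 - cmod z) * cmod (deriv (f_Lambda \<Lambda>) z)) ` unit_disc)"
    using assms by (simp add: bloch_space_def)
  then obtain C where "\<forall>y \<in> (\<lambda>z. (1 - cmod z) * cmod (deriv (f_Lambda \<Lambda>) z)) ` unit_disc. y \<le> C"
    unfolding bdd_above_def by blast
  then have C: "(1 - cmod z) * cmod (deriv (f_Lambda \<Lambda>) z) \<le> C" if "cmod z < 1" for z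
    using that by simp
  have "0 \<le> C"
    using C[of 0] order_trans[OF norm_ge_zero] by simp
  \<comment> \<open>\<open>C\<close> comes from the Bloch condition, and the extra 1 from the
    geometric series that absorbs the change of weight from \<open>n\<close> to
    \<open>Suc n\<close>.\<close>
  moreover have "(\<Sum>n<N. of_bool (n \<in> \<Lambda>) * (real (Suc n) * t ^ Suc n)) \<le> (C + 1) / (1 - t)"
    if t: "0 \<le> t" "t < 1" for t N
  proof -
    have "(\<lambda>n. complex_of_real (real (Suc n) * of_bool (Suc n \<in> \<Lambda>) * t ^ n)) =
        (\<lambda>n. of_nat (Suc n) * of_bool (Suc n \<in> \<Lambda>) * of_real t ^ n)"
      by (simp add: fun_eq_iff of_bool_def)
    then have "(\<lambda>n. complex_of_real (real (Suc n) * of_bool (Suc n \<in> \<Lambda>) * t ^ n)) sums deriv (f_Lambda \<Lambda>) (of_real t)"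
      using deriv_f_Lambda_sums[of "of_real t" \<Lambda>] t by (simp only: norm_of_real)
    then have D: "(\<lambda>n. real (Suc n) * of_bool (Suc n \<in> \<Lambda>) * t ^ n) sums Re (deriv (f_Lambda \<Lambda>) (of_real t))"
      using sums_Re by fastforce
    have "(\<Sum>n<N. real (Suc n) * of_bool (Suc n \<in> \<Lambda>) * t ^ n) \<le> Re (deriv (f_Lambda \<Lambda>) (of_real t))"
      using D t sum_le_suminf[of "\<lambda>n. real (Suc n) * of_bool (Suc n \<in> \<Lambda>) * t ^ n" "{..<N}"]
      by (simp add: sums_iff)
    also have "\<dots> \<le> cmod (deriv (f_Lambda \<Lambda>) (of_real t))"
      by (rule complex_Re_le_cmod)
    also have "\<dots> \<le> C / (1 - t)"
      using C[of "of_real t"] t by (simp add: field_simps)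
    finally have 1: "(\<Sum>n<N. real (Suc n) * of_bool (Suc n \<in> \<Lambda>) * t ^ n) \<le> C / (1 - t)" .
    have 2: "(\<Sum>n<N. t ^ n) \<le> 1 / (1 - t)"
      using t sum_le_suminf[of "\<lambda>n. t ^ n" "{..<N}"] by (simp add: suminf_geometric)
    have "(\<Sum>n<N. of_bool (n \<in> \<Lambda>) * (real (Suc n) * t ^ Suc n)) \<le>
        (\<Sum>n<Suc N. of_bool (n \<in> \<Lambda>) * (real n * t ^ Suc n)) + (\<Sum>n<N. t ^ n)"
    proof -
      have "(\<Sum>n<N. of_bool (n \<in> \<Lambda>) * (real (Suc n) * t ^ Suc n)) \<le>
          (\<Sum>n<N. of_bool (n \<in> \<Lambda>) * (real n * t ^ Suc n) + t ^ n)"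
      proof (rule sum_mono)
        fix n
        have "t * t ^ n \<le> t ^ n"
          using t by (simp add: mult_left_le_one_le)
        then show "of_bool (n \<in> \<Lambda>) * (real (Suc n) * t ^ Suc n) \<le>
            of_bool (n \<in> \<Lambda>) * (real n * t ^ Suc n) + t ^ n"
          using t by (simp add: algebra_simps)
      qed
      also have "\<dots> = (\<Sum>n<N. of_bool (n \<in> \<Lambda>) * (real n * t ^ Suc n)) + (\<Sum>n<N. t ^ n)"
        by (rule sum.distrib)
      also have "\<dots> \<le> (\<Sum>n<Suc N. of_bool (n \<in> \<Lambda>) * (real n * t ^ Suc n)) + (\<Sum>n<N. t ^ n)"
        using t by (intro add_right_mono sum_mono2) auto
      finally show ?thesis .
    qed
    \<comment> \<open>The term with index 0 vanishes, and the shift aligns the coefficients with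
      those of the derivative; the upper limit \<open>Suc N\<close> then becomes
      \<open>N\<close>.\<close>
    also have "(\<Sum>n<Suc N. of_bool (n \<in> \<Lambda>) * (real n * t ^ Suc n)) =
        (\<Sum>n<N. of_bool (Suc n \<in> \<Lambda>) * (real (Suc n) * t ^ Suc (Suc n)))"
      by (subst sum.lessThan_Suc_shift) simp
    also have "\<dots> \<le> (\<Sum>n<N. real (Suc n) * of_bool (Suc n \<in> \<Lambda>) * t ^ n)"
    proof (rule sum_mono)
      fix n
      have "t ^ Suc (Suc n) \<le> t ^ n"
        using t by (intro power_decreasing) auto
      then show "of_bool (Suc n \<in> \<Lambda>) * (real (Suc n) * t ^ Suc (Suc n)) \<le>
          real (Suc n) * of_bool (Suc n \<in> \<Lambda>) * t ^ n"
        by (auto simp del: power_Suc of_nat_Suc)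
    qed
    finally show ?thesis
      using 1 2 by (simp add: add_divide_distrib)
  qed
  ultimately show ?thesis
    using that[of "C + 1"] by auto
qed

lemma Lsum_diff_le:
  assumes C: "\<And>N. (\<Sum>n<N. of_bool (n \<in> \<Lambda>) * (real (Suc n) * a ^ Suc n)) \<le> C / (1 - a)"
    and a: "0 \<le> a" "a < 1" and t: "0 \<le> t" "t \<le> 1"
  shows "Lsum \<Lambda> a - Lsum \<Lambda> (a * t) \<le> C * ((1 - t) / (1 - a))"
proof -
  have "\<bar>a * t\<bar> < 1"
    using a t mult_left_le[of t a] by auto
  then have sums: "(\<lambda>n. of_bool (n \<in> \<Lambda>) * a ^ Suc n - of_bool (n \<in> \<Lambda>) * (a * t) ^ Suc n)
      sums (Lsum \<Lambda> a - Lsum \<Lambda> (a * t))"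
    using a by (intro sums_diff Lsum_sums) auto
  have "(\<Sum>n<N. of_bool (n \<in> \<Lambda>) * a ^ Suc n - of_bool (n \<in> \<Lambda>) * (a * t) ^ Suc n) \<le> C * ((1 - t) / (1 - a))" for N
  proof -
    have "(\<Sum>n<N. of_bool (n \<in> \<Lambda>) * a ^ Suc n - of_bool (n \<in> \<Lambda>) * (a * t) ^ Suc n) \<le>
        (\<Sum>n<N. (1 - t) * (of_bool (n \<in> \<Lambda>) * (real (Suc n) * a ^ Suc n)))"
    proof (rule sum_mono)
      fix n
      \<comment> \<open>Bernoulli's inequality for the increment \<open>t - 1\<close>, which is at
        least -1.\<close>
      have "1 - t ^ Suc n \<le> real (Suc n) * (1 - t)"
        using Bernoulli_inequality[of "t - 1" "Suc n"] t by (simp add: algebra_simps)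
      then have "a ^ Suc n * (1 - t ^ Suc n) \<le> a ^ Suc n * (real (Suc n) * (1 - t))"
        using a by (intro mult_left_mono) auto
      then show "of_bool (n \<in> \<Lambda>) * a ^ Suc n - of_bool (n \<in> \<Lambda>) * (a * t) ^ Suc n \<le>
          (1 - t) * (of_bool (n \<in> \<Lambda>) * (real (Suc n) * a ^ Suc n))"
        by (auto simp: power_mult_distrib algebra_simps simp del: power_Suc of_nat_Suc)
    qed
    also have "\<dots> = (1 - t) * (\<Sum>n<N. of_bool (n \<in> \<Lambda>) * (real (Suc n) * a ^ Suc n))"
      by (rule sum_distrib_left[symmetric])
    also have "\<dots> \<le> (1 - t) * (C / (1 - a))"
      using C t by (intro mult_left_mono) auto
    finally show ?thesis
      by (simp add: mult.commute)
  qed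
  then show ?thesis
    using sums suminf_le_const[of "\<lambda>n. of_bool (n \<in> \<Lambda>) * a ^ Suc n - of_bool (n \<in> \<Lambda>) * (a * t) ^ Suc n"]
    by (simp add: sums_iff)
qed

section \<open>Covariances and rigidity\<close>

lemma determinantal_space:
  assumes "determinantal P K"
  shows "prob_space P" "space P = Conf"
  using assms sets_eq_imp_space_eq[of P conf_borel]
  by (auto simp: determinantal_def point_process_def conf_borel_def space_measure_of_conv)

lemma Conf_bounded:
  assumes X: "X \<in> Conf" and A: "A \<in> sets borel" "bounded_in_disc A"
  shows "A \<in> sets X" "emeasure X A \<noteq> \<infinity>" "A \<in> fmeasurable X"
proof -
  have sX: "sets X = sets (restrict_space borel unit_disc)"
    using X by (simp add: Conf_def)
  have cl: "compact (closure A)" "closure A \<subseteq> unit_disc"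
    using A by (auto simp: bounded_in_disc_def)
  have sub: "A \<subseteq> closure A"
    by (rule closure_subset)
  have in_sets: "B \<in> sets X" if "B \<in> sets borel" "B \<subseteq> unit_disc" for B
    using that unfolding sX by (auto simp: sets_restrict_space)
  show 1: "A \<in> sets X"
    using A cl sub by (intro in_sets) auto
  have "emeasure X A \<le> emeasure X (closure A)"
    using cl by (intro emeasure_mono sub in_sets) auto
  also have "\<dots> < \<infinity>"
    using X cl by (auto simp: Conf_def)
  finally show "emeasure X A \<noteq> \<infinity>" by simp
  with 1 show "A \<in> fmeasurable X"
    by (auto simp: fmeasurable_def less_top)
qed

text \<open>\<open>measure\<close> takes the default value 0 on sets of infinite mass, so additivity
  rests on the finiteness of configurations on bounded sets.\<close>

lemma Conf_measure_split:
  assumes X: "X \<in> Conf" and A: "A \<in> sets borel" "bounded_in_disc A" and B: "B \<in> sets borel" "B \<subseteq> A"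
  shows "measure X A = measure X B + measure X (A - B)"
proof -
  have "closure B \<subseteq> closure A"
    using B by (intro closure_mono)
  then have B': "bounded_in_disc B"
    using A bounded_subset[of "closure A" "closure B"] by (auto simp: bounded_in_disc_def compact_eq_bounded_closed)
  show ?thesis
    using measure_Diff[of X A B] Conf_bounded[OF X A] Conf_bounded[OF X B(1) B'] B
    by simp
qed

text \<open>With \<open>N = #U\<close> and \<open>N' = #V\<close>, the product of the counts of the two discs is
  \<open>N (N - 1) + N + N N'\<close>, whose terms are factorial moments of disjoint sets.\<close>

lemma determinantal_second_moment:
  assumes P: "determinantal P (K_Lambda \<Lambda>)" and at: "0 \<le> a" "a \<le> t" "t < 1"
  shows "integrable P (\<lambda>X. measure X (annulus 0 a) * measure X (annulus 0 t))"
    and "(\<integral>X. measure X (annulus 0 a) * measure X (annulus 0 t) \<partial>P) =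
      Lsum \<Lambda> a * Lsum \<Lambda> t + Lsum \<Lambda> a - Lsum \<Lambda> (a * t)"
proof -
  let ?U = "annulus 0 a" and ?V = "annulus a t"
  define N where "N X = measure X ?U" for X
  define N' where "N' X = measure X ?V" for X
  note bounded = bounded_in_disc_annulus[of a 0] bounded_in_disc_annulus[of t a] bounded_in_disc_annulus[of t 0]
  have N: "integrable P N" "integral\<^sup>L P N = Lsum \<Lambda> a"
    using determinantal_mean[OF P, of 0 a] at by (simp_all add: N_def[abs_def])
  \<comment> \<open>One block of multiplicity two: both points range over the same disc, which is
    the case of equal regions in \<open>integral_det_2\<close>.\<close>
  note * = determinantalD[OF P, of 1 "\<lambda>_. ?U" "\<lambda>_. 2" 2 "[?U, ?U]"]
  have ff: "falling_factorial y 2 = y * (y - 1)" for y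
    by (simp add: falling_factorial_def numeral_2_eq_2)
  have prod1: "(\<Prod>i<1::nat. falling_factorial (measure X ?U) 2) = N X * (N X - 1)" for X
    by (simp add: ff N_def)
  have Bs1: "[?U, ?U] = concat (map (\<lambda>i. replicate 2 ?U) [0..<1])"
    by (simp add: numeral_2_eq_2)
  have disj1: "disjoint_family_on (\<lambda>_. ?U) {..<1::nat}"
    by (simp add: disjoint_family_on_def)
  have N2: "integrable P (\<lambda>X. N X * (N X - 1))"
    using *(1) at bounded Bs1 disj1 unfolding prod1 by simp
  have "complex_of_real (\<integral>X. N X * (N X - 1) \<partial>P) =
      of_real (Lsum \<Lambda> a * (Lsum \<Lambda> a - Lsum \<Lambda> 0) - (Lsum \<Lambda> (a * a) - Lsum \<Lambda> (a * 0)))"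
    using *(2) at bounded Bs1 disj1 integral_det_2[of a 0 a \<Lambda>] unfolding prod1 by simp
  then have EN2: "(\<integral>X. N X * (N X - 1) \<partial>P) = Lsum \<Lambda> a * Lsum \<Lambda> a - Lsum \<Lambda> (a * a)"
    unfolding of_real_eq_iff by simp
  \<comment> \<open>Two blocks of multiplicity one, the inner disc and the disjoint annulus around
    it.\<close>
  define B where "B i = (if i = 0 then ?U else ?V)" for i :: nat
  note ** = determinantalD[OF P, of 2 B "\<lambda>_. 1" 2 "[?U, ?V]"]
  have disj: "disjoint_family_on B {..<2}"
    by (auto simp: disjoint_family_on_def B_def annulus_def less_2_cases_iff)
  have B: "B i \<in> sets borel \<and> bounded_in_disc (B i)" for i
    using bounded at by (auto simp: B_def)
  have 2: "{..<2::nat} = {0, 1}" "[0..<2] = [0, 1]"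
    by (auto simp: upt_rec)
  have ff1: "falling_factorial y 1 = y" for y
    by (simp add: falling_factorial_def)
  have prod: "(\<Prod>i<2. falling_factorial (measure X (B i)) 1) = N X * N' X" for X
    unfolding 2 ff1 by (simp add: B_def N_def N'_def)
  have Bs: "[?U, ?V] = concat (map (\<lambda>i. replicate 1 (B i)) [0..<2])"
    by (simp add: 2 B_def)
  have NN': "integrable P (\<lambda>X. N X * N' X)"
    using **(1) B disj Bs unfolding prod by simp
  have "complex_of_real (\<integral>X. N X * N' X \<partial>P) =
      of_real (Lsum \<Lambda> a * (Lsum \<Lambda> t - Lsum \<Lambda> a) - (Lsum \<Lambda> (a * t) - Lsum \<Lambda> (a * a)))"
    using **(2) B disj Bs at integral_det_2[of a a t \<Lambda>] unfolding prod by simp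
  then have ENN': "(\<integral>X. N X * N' X \<partial>P) =
      Lsum \<Lambda> a * (Lsum \<Lambda> t - Lsum \<Lambda> a) - (Lsum \<Lambda> (a * t) - Lsum \<Lambda> (a * a))"
    unfolding of_real_eq_iff .
  have eq: "measure X ?U * measure X (annulus 0 t) = N X * (N X - 1) + N X + N X * N' X" if "X \<in> space P" for X
  proof -
    have "annulus 0 t - ?U = ?V" "?U \<subseteq> annulus 0 t"
      using at by (auto simp: annulus_def)
    then have "measure X (annulus 0 t) = N X + N' X"
      using Conf_measure_split[of X "annulus 0 t" ?U] that bounded at determinantal_space[OF P]
      by (simp add: N_def N'_def)
    then show ?thesis
      by (simp add: N_def algebra_simps)
  qed
  show "integrable P (\<lambda>X. measure X ?U * measure X (annulus 0 t))"
    using N N2 NN' by (subst Bochner_Integration.integrable_cong[OF refl eq]) auto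
  have "(\<integral>X. measure X ?U * measure X (annulus 0 t) \<partial>P) = (\<integral>X. N X * (N X - 1) + N X + N X * N' X \<partial>P)"
    by (rule Bochner_Integration.integral_cong[OF refl eq])
  also have "\<dots> = (\<integral>X. N X * (N X - 1) \<partial>P) + integral\<^sup>L P N + (\<integral>X. N X * N' X \<partial>P)"
    using N(1) N2 NN' by simp
  \<comment> \<open>The terms \<open>Lsum \<Lambda> (a * a)\<close> of the two factorial moments
    cancel.\<close>
  also have "\<dots> = Lsum \<Lambda> a * Lsum \<Lambda> t + Lsum \<Lambda> a - Lsum \<Lambda> (a * t)"
    unfolding EN2 ENN' N(2) by (simp add: algebra_simps)
  finally show "(\<integral>X. measure X ?U * measure X (annulus 0 t) \<partial>P) =
      Lsum \<Lambda> a * Lsum \<Lambda> t + Lsum \<Lambda> a - Lsum \<Lambda> (a * t)" .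
qed

text \<open>By \<open>determinantal_mean\<close> with inner parameter 0, \<open>u s\<close> is the
  centred count of a disc, so the product of the means is removed from the mixed second
  moment.\<close>

lemma determinantal_covariance:
  assumes P: "determinantal P (K_Lambda \<Lambda>)" and at: "0 \<le> a" "a \<le> t" "t < 1"
  defines "u \<equiv> \<lambda>s X. measure X (annulus 0 s) - Lsum \<Lambda> s"
  shows "integrable P (\<lambda>X. u a X * u t X)"
    and "(\<integral>X. u a X * u t X \<partial>P) = Lsum \<Lambda> a - Lsum \<Lambda> (a * t)"
proof -
  interpret prob_space P
    by (rule determinantal_space[OF P])
  note m = determinantal_mean[OF P, of 0 a] determinantal_mean[OF P, of 0 t] determinantal_second_moment[OF P at]
  have u: "u a X * u t X = measure X (annulus 0 a) * measure X (annulus 0 t)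
     - Lsum \<Lambda> t * measure X (annulus 0 a) - Lsum \<Lambda> a * measure X (annulus 0 t) + Lsum \<Lambda> a * Lsum \<Lambda> t" for X
    by (simp add: u_def algebra_simps)
  show "integrable P (\<lambda>X. u a X * u t X)"
    unfolding u using m at by simp
  show "(\<integral>X. u a X * u t X \<partial>P) = Lsum \<Lambda> a - Lsum \<Lambda> (a * t)"
    unfolding u using m at by (simp add: prob_space)
qed

text \<open>The modulus attains its maximum on the compact closure, and this maximum is below 1.
  Since the outer bound of an annulus is strict, \<open>t\<close> is taken strictly between its
  square and 1.\<close>

lemma bounded_in_disc_subset_annulus:
  assumes "bounded_in_disc B"
  obtains t where "0 \<le> t" "t < 1" "B \<subseteq> annulus 0 t"
proof (cases "B = {}")
  case True
  then show ?thesis using that[of 0] by simp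
next
  case False
  have cl: "compact (closure B)" "closure B \<subseteq> unit_disc" "closure B \<noteq> {}"
    using assms False by (auto simp: bounded_in_disc_def)
  then obtain z where z: "z \<in> closure B" "\<And>w. w \<in> closure B \<Longrightarrow> cmod w \<le> cmod z"
    using continuous_attains_sup[of "closure B" cmod] by (auto intro: continuous_intros)
  then have "(cmod z)\<^sup>2 < 1"
    using cl by (auto simp: abs_square_less_1)
  then obtain t where t: "(cmod z)\<^sup>2 < t" "t < 1"
    using dense by blast
  have "B \<subseteq> annulus 0 t"
  proof
    fix w assume "w \<in> B"
    then have "(cmod w)\<^sup>2 \<le> (cmod z)\<^sup>2"
      using z(2) closure_subset by (intro power_mono) auto
    then have "(cmod w)\<^sup>2 < t"
      using t by linarith
    then show "w \<in> annulus 0 t"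
      by (simp add: annulus_def)
  qed
  then show ?thesis
    using that[of t] t by (meson less_imp_le order_le_less_trans zero_le_power2)
qed

section \<open>Measurability with respect to the completed count algebra\<close>

lemma space_count_algebra [simp]: "space (count_algebra C) = Conf"
  by (simp add: count_algebra_def space_measure_of_conv)

lemma emeasure_count_algebra_measurable:
  assumes "A \<in> sets borel" "A \<subseteq> C"
  shows "(\<lambda>X. emeasure X A) \<in> borel_measurable (count_algebra C)"
proof (rule measurableI)
  fix S :: "ennreal set" assume "S \<in> sets borel"
  then have "(\<lambda>X. emeasure X A) -` S \<inter> Conf \<in>
      {(\<lambda>X. emeasure X B) -` A \<inter> Conf |B A. B \<in> sets borel \<and> B \<subseteq> C \<and> A \<in> sets (borel :: ennreal measure)}"
    using assms by blast
  then show "(\<lambda>X. emeasure X A) -` S \<inter> space (count_algebra C) \<in> sets (count_algebra C)"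
    by (simp add: count_algebra_def space_measure_of_conv) (intro in_measure_of; auto)
qed simp

text \<open>The preimages under \<open>f\<close> and \<open>g\<close> differ only inside the set
  \<open>D\<close> where the functions disagree. All subsets of \<open>D\<close> lie in the
  completed algebra, because it contains every subset of a null set of \<open>P\<close>.\<close>

lemma measurable_completed_count_algebra:
  fixes g f :: "complex measure \<Rightarrow> ennreal"
  assumes g: "g \<in> borel_measurable (count_algebra C)" and P: "space P = Conf"
    and ae: "AE X in P. g X = f X"
  shows "f \<in> borel_measurable (completed_count_algebra P C)"
proof (rule measurableI)
  have sub: "sets (count_algebra C) \<union> null_sets (completion P) \<subseteq> Pow Conf"
    using sets.sets_into_space[of _ "count_algebra C"] sets.sets_into_space[of _ "completion P"] P
    by (auto simp: null_sets_def)
  then have space: "space (completed_count_algebra P C) = Conf"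
    and sets: "sets (count_algebra C) \<subseteq> sets (completed_count_algebra P C)"
      "null_sets (completion P) \<subseteq> sets (completed_count_algebra P C)"
    by (auto simp: completed_count_algebra_def space_measure_of_conv)
  fix S :: "ennreal set" assume S: "S \<in> sets borel"
  define D where "D = {X \<in> Conf. g X \<noteq> f X}"
  obtain N where "{X \<in> space P. \<not> g X = f X} \<subseteq> N" "emeasure P N = 0" "N \<in> sets P"
    using AE_E[OF ae] .
  then have N: "N \<in> null_sets (completion P)" "D \<subseteq> N"
    by (auto simp: D_def P intro!: null_sets_completionI)
  have null: "E \<in> sets (completed_count_algebra P C)" if "E \<subseteq> D" for E
    using that N sets(2) null_sets_completion_subset[of E N P] by blast
  have "f -` S \<inter> Conf = (g -` S \<inter> Conf - D) \<union> (f -` S \<inter> D)"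
    by (auto simp: D_def)
  also have "\<dots> \<in> sets (completed_count_algebra P C)"
    using measurable_sets[OF g S] sets(1) null by (intro sets.Un sets.Diff) auto
  finally show "f -` S \<inter> space (completed_count_algebra P C) \<in> sets (completed_count_algebra P C)"
    by (simp add: space)
qed simp

section \<open>Recovery of the inner count from averages over growing discs\<close>

theorem theorem1p1:
  fixes \<Lambda> :: "nat set" and P :: "complex measure measure"
  assumes "infinite \<Lambda>"
    and "f_Lambda \<Lambda> \<in> bloch_space"
    and "determinantal P (K_Lambda \<Lambda>)"
  shows "number_rigid P"
  unfolding number_rigid_def
proof (intro conjI allI impI)
  note P = assms(3)
  show "point_process P"
    using P by (simp add: determinantal_def)
  fix B :: "complex set"
  assume B: "B \<in> sets borel" "bounded_in_disc B"
  obtain C where C: "0 \<le> C"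
    "\<And>t N. 0 \<le> t \<Longrightarrow> t < 1 \<Longrightarrow> (\<Sum>n<N. of_bool (n \<in> \<Lambda>) * (real (Suc n) * t ^ Suc n)) \<le> C / (1 - t)"
    using bloch_partial_sum_le[OF assms(2)] by blast
  obtain t where t: "0 \<le> t" "t < 1" "B \<subseteq> annulus 0 t"
    using bounded_in_disc_subset_annulus[OF B(2)] .
  \<comment> \<open>The sequence starts at \<open>t\<close>, so every disc contains
    \<open>B\<close>. The gaps to 1 halve at each step, which makes the quotient of two gaps the
    decay factor \<open>(1/2) ^ (j - i)\<close>.\<close>
  define \<tau> where "\<tau> j = 1 - (1 - t) * (1/2) ^ j" for j :: nat
  have \<tau>: "t \<le> \<tau> j" "\<tau> j < 1" for j
  proof -
    have "(1 - t) * (1/2) ^ j \<le> 1 - t"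
      using t by (intro mult_left_le power_le_one) auto
    moreover have "0 < (1 - t) * (1/2) ^ j"
      using t by simp
    ultimately show "t \<le> \<tau> j" "\<tau> j < 1"
      unfolding \<tau>_def by linarith+
  qed
  have \<tau>_mono: "\<tau> i \<le> \<tau> j" if "i \<le> j" for i j
    using t that by (auto simp: \<tau>_def intro!: mult_left_mono power_decreasing)
  define u where "u j X = measure X (annulus 0 (\<tau> j)) - Lsum \<Lambda> (\<tau> j)" for j X
  have cov: "integrable P (\<lambda>X. u i X * u j X)" "(\<integral>X. u i X * u j X \<partial>P) \<le> C * (1/2) ^ (j - i)" if "i \<le> j" for i j
  proof -
    have ij: "0 \<le> \<tau> i" "\<tau> i \<le> \<tau> j" "\<tau> j < 1" "\<tau> i < 1" "0 \<le> \<tau> j"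
      using \<tau>[of i] \<tau>[of j] \<tau>_mono[OF that] t by auto
    note cv = determinantal_covariance[OF P ij(1-3), folded u_def]
    show "integrable P (\<lambda>X. u i X * u j X)"
      by (rule cv)
    have "(1 - \<tau> j) / (1 - \<tau> i) = (1/2) ^ j / (1/2) ^ i"
      using t by (simp add: \<tau>_def)
    also have "\<dots> = (1/2) ^ (j - i)"
      using that by (simp add: power_diff)
    finally show "(\<integral>X. u i X * u j X \<partial>P) \<le> C * (1/2) ^ (j - i)"
      using Lsum_diff_le[of \<Lambda> "\<tau> i" C "\<tau> j"] C(2)[of "\<tau> i"] ij cv(2) by simp
  qed
  have int: "integrable P (\<lambda>X. u i X * u j X)" for i j
    using cov(1)[of i j] cov(1)[of j i] by (cases "i \<le> j") (simp_all add: mult.commute)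
  obtain r :: "nat \<Rightarrow> nat"
    where r: "AE X in P. (\<lambda>k. (\<Sum>j<Suc (r k). u j X) / real (Suc (r k))) \<longlonglongrightarrow> 0"
    using average_AE_subseq_tendsto_0[of P u C] int cov(2) C(1) by blast
  let ?M = "count_algebra (unit_disc - B)"
  \<comment> \<open>Built only from counts outside \<open>B\<close>; the sign is chosen so that the
    average of the \<open>u j\<close> equals the count of \<open>B\<close> minus
    \<open>v k\<close>.\<close>
  define v where "v k X = - ((\<Sum>j<Suc (r k). measure X (annulus 0 (\<tau> j) - B) - Lsum \<Lambda> (\<tau> j)) / real (Suc (r k)))" for k X
  have sub: "annulus 0 (\<tau> j) - B \<subseteq> unit_disc - B" for j
    using annulus_cmod_less_1[of _ 0 "\<tau> j"] \<tau>(2)[of j] by auto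
  have [measurable]: "(\<lambda>X. measure X (annulus 0 (\<tau> j) - B)) \<in> borel_measurable ?M" for j
    unfolding measure_def using B sub by (intro measurable_compose[OF emeasure_count_algebra_measurable]) auto
  have [measurable]: "v k \<in> borel_measurable ?M" for k
    unfolding v_def by measurable
  \<comment> \<open>The total function \<open>lim\<close> is measurable here; its value where the
    sequence diverges matters only on a null set.\<close>
  have Y: "(\<lambda>X. ennreal (lim (\<lambda>k. v k X))) \<in> borel_measurable ?M"
    by measurable
  have space_P: "space P = Conf"
    using determinantal_space[OF P] by simp
  have "AE X in P. ennreal (lim (\<lambda>k. v k X)) = emeasure X B"
    using r AE_space
  proof eventually_elim
    case (elim X)
    then have X: "X \<in> Conf"
      by (simp add: space_P)
    have "B \<subseteq> annulus 0 (\<tau> j)" for j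
      using t(3) \<tau>(1)[of j] by (force simp: annulus_def)
    then have "u j X = measure X B + (measure X (annulus 0 (\<tau> j) - B) - Lsum \<Lambda> (\<tau> j))" for j
      unfolding u_def using \<tau>(2)[of j] B X Conf_measure_split[of X "annulus 0 (\<tau> j)" B] bounded_in_disc_annulus
      by simp
    then have "(\<Sum>j<Suc (r k). u j X) / real (Suc (r k)) = measure X B - v k X" for k
      unfolding v_def by (simp add: sum.distrib add_divide_distrib del: sum.lessThan_Suc of_nat_Suc)
    then have "(\<lambda>k. measure X B - v k X) \<longlonglongrightarrow> 0"
      using elim(1) by simp
    then have "(\<lambda>k. v k X) \<longlonglongrightarrow> measure X B"
      using tendsto_diff[OF tendsto_const[of "measure X B"]] by fastforce
    then have "lim (\<lambda>k. v k X) = measure X B"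
      by (rule limI)
    \<comment> \<open>The count of the bounded set \<open>B\<close> is finite, so its real and
      extended values correspond.\<close>
    then show ?case
      using Conf_bounded(2)[OF X B] by (simp add: emeasure_eq_ennreal_measure)
  qed
  then show "(\<lambda>X. emeasure X B) \<in> borel_measurable (completed_count_algebra P (unit_disc - B))"
    by (rule measurable_completed_count_algebra[OF Y space_P])
qed

end
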